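(* Let $k$ be an algebraically closed field of characteristic $\neq 3$ and let $\omega\in k$ be a primitive cubic root of $1$. Then every nontrivial group grading of the pseudo-octonion algebra $P_8(k)$ is, up to isomorphism, a coarsening of one of the following two gradings: (a) the $\mathbb{Z}^2$-grading of $S=\overline{C(k)}_{\tau_\omega}\cong P_8(k)$ given by $S_{(0,0)}=\mathrm{span}\{e_1,e_2\}$, $S_{(1,0)}=ku_1$, $S_{(0,1)}=ku_2$, $S_{(1,1)}=kv_3$, $S_{(-1,0)}=kv_1$, $S_{(0,-1)}=kv_2$, $S_{(-1,-1)}=ku_3$; (b) the standard $\mathbb{Z}_3^2$-grading of an Okubo algebra $\mathcal{O}_{\alpha,\beta}\cong P_8(k)$, with $0\ne\alpha,\beta\in k$.
   Context: A composition algebra $(S,*,n)$ over $k$ is a vector space with a bilinear multiplication and a quadratic form $n$ with nondegenerate polar form $n(x,y)=n(x+y)-n(x)-n(y)$ such that $n(x*y)=n(x)n(y)$. For a unital composition algebra $(C,\cdot,n)$ put $\bar x=n(x,1)1-x$; if $\tau$ is an automorphism of $C$ with $\tau^3=1$, the Petersson algebra $\bar C_\tau$ is $(C,*,n)$ with $x*y=\tau(\bar x)\cdot\tau^2(\bar y)$. The split Cayley algebra $C(k)$ has a basis $e_1,e_2,u_1,u_2,u_3,v_1,v_2,v_3$ with (indices of $u,v$ mod $3$) $e_1^2=e_1$, $e_2^2=e_2$, $e_1u_i=u_i=u_ie_2$, $e_2v_i=v_i=v_ie_1$, $u_iu_{i+1}=v_{i+2}=-u_{i+1}u_i$, $v_iv_{i+1}=u_{i+2}=-v_{i+1}v_i$,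 $u_iv_i=-e_1$, $v_iu_i=-e_2$, all other products of basis elements being $0$; basis elements are isotropic, $n(e_1,e_2)=1=n(u_i,v_i)$, all other pairs of distinct basis elements are orthogonal. Define automorphisms fixing $e_1,e_2$ by $\tau_{st}(u_i)=u_{i+1}$, $\tau_{st}(v_i)=v_{i+1}$ (mod $3$), and $\tau_\omega(u_i)=\omega^iu_i$, $\tau_\omega(v_i)=\omega^{-i}v_i$ ($i=1,2,3$). The pseudo-octonion algebra is $P_8(k)=\overline{C(k)}_{\tau_{st}}$. The algebra $\mathcal{O}_{\alpha,\beta}$ ($0\ne\alpha,\beta\in k$) has basis $\{x_{i,j}:-1\le i,j\le1,(i,j)\ne(0,0)\}$ and products (those not listed are $0$): $x_{1,0}*x_{1,0}=-\alpha x_{-1,0}$, $x_{1,0}*x_{0,-1}=x_{1,-1}$, $x_{1,0}*x_{-1,-1}=x_{0,-1}$, $x_{1,0}*x_{1,-1}=\alpha x_{-1,-1}$; $x_{-1,0}*x_{-1,0}=-\alpha^{-1}x_{1,0}$, $x_{-1,0}*x_{0,1}=x_{-1,1}$, $x_{-1,0}*x_{1,1}=x_{0,1}$, $x_{-1,0}*x_{-1,1}=\alpha^{-1}x_{1,1}$; $x_{0,1}*x_{1,0}=x_{1,1}$, $x_{0,1}*x_{0,1}=-\beta x_{0,-1}$, $x_{0,1}*x_{1,1}=\beta x_{1,-1}$, $x_{0,1}*x_{1,-1}=x_{1,0}$; $x_{0,-1}*x_{-1,0}=x_{-1,-1}$, $x_{0,-1}*x_{0,-1}=-\beta^{-1}x_{0,1}$,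 $x_{0,-1}*x_{-1,-1}=\beta^{-1}x_{-1,1}$, $x_{0,-1}*x_{-1,1}=x_{-1,0}$; $x_{1,1}*x_{1,0}=\alpha x_{-1,1}$, $x_{1,1}*x_{0,-1}=x_{1,0}$, $x_{1,1}*x_{1,1}=-\alpha\beta x_{-1,-1}$, $x_{1,1}*x_{-1,1}=\beta x_{0,-1}$; $x_{-1,-1}*x_{-1,0}=\alpha^{-1}x_{1,-1}$, $x_{-1,-1}*x_{0,1}=x_{-1,0}$, $x_{-1,-1}*x_{-1,-1}=-(\alpha\beta)^{-1}x_{1,1}$, $x_{-1,-1}*x_{1,-1}=\beta^{-1}x_{0,1}$; $x_{-1,1}*x_{1,0}=x_{0,1}$, $x_{-1,1}*x_{0,1}=\beta x_{-1,-1}$, $x_{-1,1}*x_{-1,-1}=\alpha^{-1}x_{1,0}$, $x_{-1,1}*x_{-1,1}=-\alpha^{-1}\beta x_{1,-1}$; $x_{1,-1}*x_{-1,0}=x_{0,-1}$, $x_{1,-1}*x_{0,-1}=\beta^{-1}x_{1,1}$, $x_{1,-1}*x_{1,1}=\alpha x_{-1,0}$, $x_{1,-1}*x_{1,-1}=-\alpha\beta^{-1}x_{-1,1}$. Its standard $\mathbb{Z}_3^2$-grading has $x_{i,j}$ homogeneous of degree $(\bar\imath,\bar\jmath)$. A group grading of an algebra $A$ by a group $G$ is $A=\bigoplus_{g\in G}A_g$ with $A_gA_h\subseteq A_{gh}$; $G$ is assumed to be generated by $\{g:A_g\ne0\}$. It is nontrivial if $A$ is not equal to the component of the neutral element. A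 grading $\bigoplus_gA_g$ is a coarsening of a grading $\bigoplus_hA'_h$ of the same algebra if each $A'_h$ is contained in some $A_g$. "Up to isomorphism" means after transporting the grading by some algebra isomorphism from $P_8(k)$ onto the algebra on which (a) or (b) is defined. *)

theory Defs
  imports "HOL-Analysis.Analysis" "HOL-Algebra.Elementary_Groups" "HOL-Algebra.Generated_Groups"
begin

section \<open>Finite-dimensional algebras given by structure constants\<close>

text \<open>An algebra over \<open>'k\<close> is a bilinear product on the space \<open>'k ^ 'b\<close>, where \<open>'b\<close> is the finite
  type of labels of a distinguished basis.\<close>

definition bas :: "'b::finite \<Rightarrow> 'k::field ^ 'b" where
  "bas b = axis b 1"

definition linear_ext :: "('b::finite \<Rightarrow> 'k::field ^ 'c::finite) \<Rightarrow> 'k ^ 'b \<Rightarrow> 'k ^ 'c" where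
  "linear_ext f x = (\<Sum>a\<in>UNIV. (x $ a) *s f a)"

definition bilinear_ext ::
    "('b::finite \<Rightarrow> 'b \<Rightarrow> 'k::field ^ 'b) \<Rightarrow> 'k ^ 'b \<Rightarrow> 'k ^ 'b \<Rightarrow> 'k ^ 'b" where
  "bilinear_ext t x y = (\<Sum>a\<in>UNIV. \<Sum>b\<in>UNIV. (x $ a * y $ b) *s t a b)"

definition algebra_iso ::
    "('k::field ^ 'b::finite \<Rightarrow> 'k ^ 'b \<Rightarrow> 'k ^ 'b) \<Rightarrow> ('k ^ 'c::finite \<Rightarrow> 'k ^ 'c \<Rightarrow> 'k ^ 'c)
      \<Rightarrow> ('k ^ 'b \<Rightarrow> 'k ^ 'c) \<Rightarrow> bool" where
  "algebra_iso m m' \<phi> \<longleftrightarrow>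
     Vector_Spaces.linear (*s) (*s) \<phi> \<and> bij \<phi> \<and> (\<forall>x y. \<phi> (m x y) = m' (\<phi> x) (\<phi> y))"

lemma linear_ext_bas: "linear_ext f (bas a) = f a"
proof -
  have "linear_ext f (bas a) = (\<Sum>b\<in>UNIV. if b = a then f b else 0)"
    unfolding linear_ext_def bas_def axis_def by (intro sum.cong) auto
  then show ?thesis by simp
qed

lemma bilinear_ext_bas: "bilinear_ext t (bas a) (bas b) = t a b"
proof -
  have "bilinear_ext t (bas a) (bas b) =
      (\<Sum>c\<in>UNIV. \<Sum>d\<in>UNIV. if c = a then if d = b then t c d else 0 else 0)"
    unfolding bilinear_ext_def bas_def axis_def by (intro sum.cong refl) auto
  also have "\<dots> = (\<Sum>c\<in>UNIV. if c = a then t c b else 0)"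
    by (intro sum.cong refl) simp
  finally show ?thesis by simp
qed


section \<open>Group gradings\<close>

text \<open>\<open>A g\<close> is the homogeneous component of degree \<open>g\<close>; only its values on \<open>carrier G\<close> matter.\<close>

definition is_direct_sum :: "'g set \<Rightarrow> ('g \<Rightarrow> ('k::field ^ 'b::finite) set) \<Rightarrow> bool" where
  "is_direct_sum I A \<longleftrightarrow>
     (\<forall>i\<in>I. vec.subspace (A i)) \<and>
     (\<forall>x. \<exists>!c. (\<forall>i\<in>I. c i \<in> A i) \<and> (\<forall>i. i \<notin> I \<longrightarrow> c i = 0) \<and>
              finite {i. c i \<noteq> 0} \<and> x = (\<Sum>i | c i \<noteq> 0. c i))"

definition group_grading ::
    "('g, 'm) monoid_scheme \<Rightarrow> ('k::field ^ 'b::finite \<Rightarrow> 'k ^ 'b \<Rightarrow> 'k ^ 'b)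
      \<Rightarrow> ('g \<Rightarrow> ('k ^ 'b) set) \<Rightarrow> bool" where
  "group_grading G m A \<longleftrightarrow>
     group G \<and>
     is_direct_sum (carrier G) A \<and>
     (\<forall>g\<in>carrier G. \<forall>h\<in>carrier G. \<forall>x\<in>A g. \<forall>y\<in>A h. m x y \<in> A (g \<otimes>\<^bsub>G\<^esub> h)) \<and>
     generate G {g \<in> carrier G. A g \<noteq> {0}} = carrier G"

definition nontrivial_grading ::
    "('g, 'm) monoid_scheme \<Rightarrow> ('g \<Rightarrow> ('k::field ^ 'b::finite) set) \<Rightarrow> bool" where
  "nontrivial_grading G A \<longleftrightarrow> A \<one>\<^bsub>G\<^esub> \<noteq> UNIV"

definition coarsening ::
    "('g, 'm) monoid_scheme \<Rightarrow> ('g \<Rightarrow> 'v set) \<Rightarrow> ('h, 'n) monoid_scheme \<Rightarrow> ('h \<Rightarrow> 'v set) \<Rightarrow> bool" where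
  "coarsening G A H B \<longleftrightarrow> (\<forall>h\<in>carrier H. \<exists>g\<in>carrier G. B h \<subseteq> A g)"

definition transport :: "('v \<Rightarrow> 'w) \<Rightarrow> ('g \<Rightarrow> 'v set) \<Rightarrow> 'g \<Rightarrow> 'w set" where
  "transport \<phi> A g = \<phi> ` A g"

definition component_of_degree :: "('b::finite \<Rightarrow> 'd) \<Rightarrow> 'd \<Rightarrow> ('k::field ^ 'b) set" where
  "component_of_degree deg d = vec.span {bas b | b. deg b = d}"


section \<open>Petersson algebras\<close>

definition polar :: "('k::field ^ 'b::finite \<Rightarrow> 'k) \<Rightarrow> 'k ^ 'b \<Rightarrow> 'k ^ 'b \<Rightarrow> 'k" where
  "polar n x y = n (x + y) - n x - n y"

definition conjugation :: "('k::field ^ 'b::finite \<Rightarrow> 'k) \<Rightarrow> 'k ^ 'b \<Rightarrow> 'k ^ 'b \<Rightarrow> 'k ^ 'b" where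
  "conjugation n e x = polar n x e *s e - x"

text \<open>The Petersson algebra of the unital composition algebra with product \<open>m\<close>, norm \<open>n\<close> and
  unit \<open>e\<close>, with respect to \<open>\<tau>\<close>.\<close>

definition petersson ::
    "('k::field ^ 'b::finite \<Rightarrow> 'k ^ 'b \<Rightarrow> 'k ^ 'b) \<Rightarrow> ('k ^ 'b \<Rightarrow> 'k) \<Rightarrow> 'k ^ 'b \<Rightarrow> ('k ^ 'b \<Rightarrow> 'k ^ 'b)
      \<Rightarrow> 'k ^ 'b \<Rightarrow> 'k ^ 'b \<Rightarrow> 'k ^ 'b" where
  "petersson m n e \<tau> x y = m (\<tau> (conjugation n e x)) (\<tau> (\<tau> (conjugation n e y)))"


section \<open>The split Cayley algebra\<close>

text \<open>The indices of \<open>u\<close> and \<open>v\<close> live in the three-element type \<open>3\<close>, whose arithmetic is modulo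
  three, so that the index \<open>3\<close> is \<open>0\<close>.\<close>

datatype cayley_basis = E1 | E2 | U "3" | V "3"

instance cayley_basis :: finite
proof
  have "(UNIV :: cayley_basis set) = {E1, E2} \<union> range U \<union> range V"
    using cayley_basis.exhaust by blast
  moreover have "finite ({E1, E2} \<union> range U \<union> range V)" by simp
  ultimately show "finite (UNIV :: cayley_basis set)" by (simp only:)
qed

fun cayley_table :: "cayley_basis \<Rightarrow> cayley_basis \<Rightarrow> 'k::field ^ cayley_basis" where
  "cayley_table E1 E1 = bas E1" |
  "cayley_table E1 E2 = 0" |
  "cayley_table E2 E1 = 0" |
  "cayley_table E2 E2 = bas E2" |
  "cayley_table E1 (U i) = bas (U i)" |
  "cayley_table E1 (V i) = 0" |
  "cayley_table E2 (U i) = 0" |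
  "cayley_table E2 (V i) = bas (V i)" |
  "cayley_table (U i) E1 = 0" |
  "cayley_table (U i) E2 = bas (U i)" |
  "cayley_table (V i) E1 = bas (V i)" |
  "cayley_table (V i) E2 = 0" |
  "cayley_table (U i) (U j) =
     (if j = i + 1 then bas (V (i + 2)) else if i = j + 1 then - bas (V (j + 2)) else 0)" |
  "cayley_table (V i) (V j) =
     (if j = i + 1 then bas (U (i + 2)) else if i = j + 1 then - bas (U (j + 2)) else 0)" |
  "cayley_table (U i) (V j) = (if i = j then - bas E1 else 0)" |
  "cayley_table (V i) (U j) = (if i = j then - bas E2 else 0)"

definition cayley_mult ::
    "'k::field ^ cayley_basis \<Rightarrow> 'k ^ cayley_basis \<Rightarrow> 'k ^ cayley_basis" where
  "cayley_mult = bilinear_ext cayley_table"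

definition cayley_one :: "'k::field ^ cayley_basis" where
  "cayley_one = bas E1 + bas E2"

text \<open>The quadratic form for which the basis elements are isotropic and the only pairs of distinct
  basis elements with nonzero polar form are \<open>(e\<^sub>1, e\<^sub>2)\<close> and \<open>(u\<^sub>i, v\<^sub>i)\<close>, with value \<open>1\<close>.\<close>

definition cayley_norm :: "'k::field ^ cayley_basis \<Rightarrow> 'k" where
  "cayley_norm x = x $ E1 * x $ E2 + (\<Sum>i\<in>UNIV. x $ U i * x $ V i)"

fun tau_st_table :: "cayley_basis \<Rightarrow> 'k::field ^ cayley_basis" where
  "tau_st_table E1 = bas E1" |
  "tau_st_table E2 = bas E2" |
  "tau_st_table (U i) = bas (U (i + 1))" |
  "tau_st_table (V i) = bas (V (i + 1))"

definition tau_st :: "'k::field ^ cayley_basis \<Rightarrow> 'k ^ cayley_basis" where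
  "tau_st = linear_ext tau_st_table"

definition index_power :: "'k::field \<Rightarrow> 3 \<Rightarrow> 'k" where
  "index_power w i = (if i = 1 then w else if i = 2 then w ^ 2 else w ^ 3)"

fun tau_omega_table :: "'k::field \<Rightarrow> cayley_basis \<Rightarrow> 'k ^ cayley_basis" where
  "tau_omega_table \<omega> E1 = bas E1" |
  "tau_omega_table \<omega> E2 = bas E2" |
  "tau_omega_table \<omega> (U i) = index_power \<omega> i *s bas (U i)" |
  "tau_omega_table \<omega> (V i) = inverse (index_power \<omega> i) *s bas (V i)"

definition tau_omega :: "'k::field \<Rightarrow> 'k ^ cayley_basis \<Rightarrow> 'k ^ cayley_basis" where
  "tau_omega \<omega> = linear_ext (tau_omega_table \<omega>)"

definition pseudo_octonion_mult ::
    "'k::field ^ cayley_basis \<Rightarrow> 'k ^ cayley_basis \<Rightarrow> 'k ^ cayley_basis" where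
  "pseudo_octonion_mult = petersson cayley_mult cayley_norm cayley_one tau_st"

definition cayley_omega_mult ::
    "'k::field \<Rightarrow> 'k ^ cayley_basis \<Rightarrow> 'k ^ cayley_basis \<Rightarrow> 'k ^ cayley_basis" where
  "cayley_omega_mult \<omega> = petersson cayley_mult cayley_norm cayley_one (tau_omega \<omega>)"

definition primitive_root_of_one :: "nat \<Rightarrow> 'k::field \<Rightarrow> bool" where
  "primitive_root_of_one n w \<longleftrightarrow> n > 0 \<and> w ^ n = 1 \<and> (\<forall>m. 0 < m \<and> m < n \<longrightarrow> w ^ m \<noteq> 1)"

definition Z2_group :: "(int \<times> int) monoid" where
  "Z2_group = integer_group \<times>\<times> integer_group"

fun cayley_degree :: "cayley_basis \<Rightarrow> int \<times> int" where
  "cayley_degree E1 = (0, 0)" |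
  "cayley_degree E2 = (0, 0)" |
  "cayley_degree (U i) = (if i = 1 then (1, 0) else if i = 2 then (0, 1) else (-1, -1))" |
  "cayley_degree (V i) = (if i = 1 then (-1, 0) else if i = 2 then (0, -1) else (1, 1))"

definition Z2_grading :: "int \<times> int \<Rightarrow> ('k::field ^ cayley_basis) set" where
  "Z2_grading = component_of_degree cayley_degree"


section \<open>The Okubo algebras\<close>

text \<open>The two letters in the name of a basis element are its indices \<open>i\<close> and \<open>j\<close>, with
  \<open>P\<close>, \<open>Z\<close>, \<open>M\<close> standing for \<open>1\<close>, \<open>0\<close>, \<open>-1\<close>.\<close>

datatype okubo_basis = X_PZ | X_MZ | X_ZP | X_ZM | X_PP | X_MM | X_MP | X_PM

instance okubo_basis :: finite
proof
  have "(UNIV :: okubo_basis set) = {X_PZ, X_MZ, X_ZP, X_ZM, X_PP, X_MM, X_MP, X_PM}"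
    using okubo_basis.exhaust by blast
  then show "finite (UNIV :: okubo_basis set)" by (metis finite.emptyI finite_insert)
qed

fun okubo_index :: "okubo_basis \<Rightarrow> int \<times> int" where
  "okubo_index X_PZ = (1, 0)" |
  "okubo_index X_MZ = (-1, 0)" |
  "okubo_index X_ZP = (0, 1)" |
  "okubo_index X_ZM = (0, -1)" |
  "okubo_index X_PP = (1, 1)" |
  "okubo_index X_MM = (-1, -1)" |
  "okubo_index X_MP = (-1, 1)" |
  "okubo_index X_PM = (1, -1)"

fun okubo_table :: "'k::field \<Rightarrow> 'k \<Rightarrow> okubo_basis \<Rightarrow> okubo_basis \<Rightarrow> 'k ^ okubo_basis" where
  "okubo_table \<alpha> \<beta> X_PZ X_PZ = (- \<alpha>) *s bas X_MZ" |
  "okubo_table \<alpha> \<beta> X_PZ X_ZM = bas X_PM" |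
  "okubo_table \<alpha> \<beta> X_PZ X_MM = bas X_ZM" |
  "okubo_table \<alpha> \<beta> X_PZ X_PM = \<alpha> *s bas X_MM" |
  "okubo_table \<alpha> \<beta> X_MZ X_MZ = (- inverse \<alpha>) *s bas X_PZ" |
  "okubo_table \<alpha> \<beta> X_MZ X_ZP = bas X_MP" |
  "okubo_table \<alpha> \<beta> X_MZ X_PP = bas X_ZP" |
  "okubo_table \<alpha> \<beta> X_MZ X_MP = inverse \<alpha> *s bas X_PP" |
  "okubo_table \<alpha> \<beta> X_ZP X_PZ = bas X_PP" |
  "okubo_table \<alpha> \<beta> X_ZP X_ZP = (- \<beta>) *s bas X_ZM" |
  "okubo_table \<alpha> \<beta> X_ZP X_PP = \<beta> *s bas X_PM" |
  "okubo_table \<alpha> \<beta> X_ZP X_PM = bas X_PZ" |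
  "okubo_table \<alpha> \<beta> X_ZM X_MZ = bas X_MM" |
  "okubo_table \<alpha> \<beta> X_ZM X_ZM = (- inverse \<beta>) *s bas X_ZP" |
  "okubo_table \<alpha> \<beta> X_ZM X_MM = inverse \<beta> *s bas X_MP" |
  "okubo_table \<alpha> \<beta> X_ZM X_MP = bas X_MZ" |
  "okubo_table \<alpha> \<beta> X_PP X_PZ = \<alpha> *s bas X_MP" |
  "okubo_table \<alpha> \<beta> X_PP X_ZM = bas X_PZ" |
  "okubo_table \<alpha> \<beta> X_PP X_PP = (- (\<alpha> * \<beta>)) *s bas X_MM" |
  "okubo_table \<alpha> \<beta> X_PP X_MP = \<beta> *s bas X_ZM" |
  "okubo_table \<alpha> \<beta> X_MM X_MZ = inverse \<alpha> *s bas X_PM" |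
  "okubo_table \<alpha> \<beta> X_MM X_ZP = bas X_MZ" |
  "okubo_table \<alpha> \<beta> X_MM X_MM = (- inverse (\<alpha> * \<beta>)) *s bas X_PP" |
  "okubo_table \<alpha> \<beta> X_MM X_PM = inverse \<beta> *s bas X_ZP" |
  "okubo_table \<alpha> \<beta> X_MP X_PZ = bas X_ZP" |
  "okubo_table \<alpha> \<beta> X_MP X_ZP = \<beta> *s bas X_MM" |
  "okubo_table \<alpha> \<beta> X_MP X_MM = inverse \<alpha> *s bas X_PZ" |
  "okubo_table \<alpha> \<beta> X_MP X_MP = (- (inverse \<alpha> * \<beta>)) *s bas X_PM" |
  "okubo_table \<alpha> \<beta> X_PM X_MZ = bas X_ZM" |
  "okubo_table \<alpha> \<beta> X_PM X_ZM = inverse \<beta> *s bas X_PP" |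
  "okubo_table \<alpha> \<beta> X_PM X_PP = \<alpha> *s bas X_MZ" |
  "okubo_table \<alpha> \<beta> X_PM X_PM = (- (\<alpha> * inverse \<beta>)) *s bas X_MP" |
  "okubo_table \<alpha> \<beta> _ _ = 0"

definition okubo_mult ::
    "'k::field \<Rightarrow> 'k \<Rightarrow> 'k ^ okubo_basis \<Rightarrow> 'k ^ okubo_basis \<Rightarrow> 'k ^ okubo_basis" where
  "okubo_mult \<alpha> \<beta> = bilinear_ext (okubo_table \<alpha> \<beta>)"

definition Z33_group :: "(int \<times> int) monoid" where
  "Z33_group = integer_mod_group 3 \<times>\<times> integer_mod_group 3"

definition okubo_degree :: "okubo_basis \<Rightarrow> int \<times> int" where
  "okubo_degree b = (fst (okubo_index b) mod 3, snd (okubo_index b) mod 3)"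

definition Z33_grading :: "int \<times> int \<Rightarrow> ('k::field ^ okubo_basis) set" where
  "Z33_grading = component_of_degree okubo_degree"

end

(* For a primitive cube root of unity w, the pseudo-octonion algebra is the space of traceless 3 x 3
   matrices with x * y = w xy - w^2 yx - (w - w^2)/3 tr(xy) 1.  The symmetric composition identity
   (a * c) * b + (b * c) * a = - tr(ab) c forces the support of a grading to commute, so adjoining
   the scalars in degree 1 turns a grading of the algebra into a grading of the full matrix algebra
   R.  If R_1 contains a nonscalar element, then it contains an idempotent of rank one, hence a
   complete system of such idempotents; in the resulting basis the matrix units are homogeneous,
   which is grading (a).  Otherwise R_1 consists of scalars, every homogeneous element is invertible
   with scalar cube, and two noncommuting homogeneous elements, suitably scaled, are conjugate to
   the clock and shift matrices, which gives grading (b). *)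

theory Submission
  imports Defs
begin

section \<open>Three-by-three matrices\<close>

text \<open>A matrix product \<open>x y\<close> is recovered, up to a scalar, from the two products
  \<open>x * y\<close> and \<open>y * x\<close> of the algebra taken together. These must have the
  same degree before the matrices can inherit a grading, and for a group that may be nonabelian this
  needs a proof; that is the task of the symmetric composition identity.

  The substitute is the trace form. It is nondegenerate and vanishes on components of degrees
  \<open>g\<close> and \<open>h\<close> unless \<open>g h = 1\<close>, so each nonzero homogeneous
  \<open>x\<close> has a homogeneous partner \<open>y\<close> such that \<open>x y\<close> has
  degree 1 and nonzero trace. Such products supply idempotents in the first case and inverses in the
  second. Algebraic closedness enters through an eigenvalue and through cube roots.\<close>

datatype 'a mat3 = Mat 'a 'a 'a 'a 'a 'a 'a 'a 'a

text \<open>Nine explicit entries, listed by rows, turn matrix identities into polynomial identities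
  that \<open>algebra_simps\<close> settles.\<close>

instantiation mat3 :: (comm_ring_1) ring_1
begin

definition "0 = Mat 0 0 0 0 0 0 0 0 0"
definition "1 = Mat 1 0 0 0 1 0 0 0 1"

fun plus_mat3 where
  "Mat a b c d e f g h i + Mat a' b' c' d' e' f' g' h' i' =
     Mat (a + a') (b + b') (c + c') (d + d') (e + e') (f + f') (g + g') (h + h') (i + i')"

fun minus_mat3 where
  "Mat a b c d e f g h i - Mat a' b' c' d' e' f' g' h' i' =
     Mat (a - a') (b - b') (c - c') (d - d') (e - e') (f - f') (g - g') (h - h') (i - i')"

fun uminus_mat3 where
  "- Mat a b c d e f g h i = Mat (-a) (-b) (-c) (-d) (-e) (-f) (-g) (-h) (-i)"

fun times_mat3 where
  "Mat a b c d e f g h i * Mat a' b' c' d' e' f' g' h' i' =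
     Mat (a*a' + b*d' + c*g') (a*b' + b*e' + c*h') (a*c' + b*f' + c*i')
         (d*a' + e*d' + f*g') (d*b' + e*e' + f*h') (d*c' + e*f' + f*i')
         (g*a' + h*d' + i*g') (g*b' + h*e' + i*h') (g*c' + h*f' + i*i')"

instance
proof
  fix x y z :: "'a mat3"
  show "x * y * z = x * (y * z)"
    by (cases x; cases y; cases z) (simp add: algebra_simps)
  show "(x + y) * z = x * z + y * z" "x * (y + z) = x * y + x * z"
    by (cases x; cases y; cases z; simp add: algebra_simps)+
  show "x + y + z = x + (y + z)"
    by (cases x; cases y; cases z) (simp add: algebra_simps)
  show "x + y = y + x" by (cases x; cases y) simp
  show "0 + x = x" "1 * x = x" "x * 1 = x" "- x + x = 0"
    by (cases x; simp add: zero_mat3_def one_mat3_def)+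
  show "x - y = x + - y" by (cases x; cases y) simp
  show "(0 :: 'a mat3) \<noteq> 1" by (simp add: zero_mat3_def one_mat3_def)
qed

end

text \<open>Scalars are embedded as matrices, so that scaling is ring multiplication and ring
  simplification covers it.\<close>

definition scal :: "'a::comm_ring_1 \<Rightarrow> 'a mat3" where
  "scal c = Mat c 0 0 0 c 0 0 0 c"

fun tr :: "'a::comm_ring_1 mat3 \<Rightarrow> 'a" where
  "tr (Mat a b c d e f g h i) = a + e + i"

text \<open>The second elementary symmetric function of the eigenvalues. Principal minors give it
  without the denominator 2 of \<open>((tr x)^2 - tr (x * x)) / 2\<close>.\<close>

fun minor_sum :: "'a::comm_ring_1 mat3 \<Rightarrow> 'a" where
  "minor_sum (Mat a b c d e f g h i) = (a*e - b*d) + (a*i - c*g) + (e*i - f*h)"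

fun det3 :: "'a::comm_ring_1 mat3 \<Rightarrow> 'a" where
  "det3 (Mat a b c d e f g h i) = a*(e*i - f*h) - b*(d*i - f*g) + c*(d*h - e*g)"

lemma scal_0 [simp]: "scal 0 = 0" and scal_1 [simp]: "scal 1 = 1"
  by (simp_all add: scal_def zero_mat3_def one_mat3_def)

lemma scal_add: "scal (a + b) = scal a + scal b"
  and scal_diff: "scal (a - b) = scal a - scal b"
  and scal_minus: "scal (- a) = - scal a"
  and scal_mult: "scal (a * b) = scal a * scal b"
  by (simp_all add: scal_def)

lemma scal_eq_iff [simp]: "scal a = scal b \<longleftrightarrow> a = b"
  by (simp add: scal_def)

lemma scal_eq_0_iff [simp]: "scal a = 0 \<longleftrightarrow> a = 0"
  by (simp add: scal_def zero_mat3_def)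

lemma scal_commute: "x * scal c = scal c * x"
  by (cases x) (simp add: scal_def algebra_simps)

lemma scal_left_commute: "x * (scal c * y) = scal c * (x * y)"
  by (metis mult.assoc scal_commute)

lemma scal_left_cancel:
  fixes x y :: "'a::field mat3"
  assumes "c \<noteq> 0" "scal c * x = scal c * y"
  shows "x = y"
proof -
  have "scal (inverse c) * (scal c * z) = z" for z :: "'a mat3"
    using assms(1) by (simp add: mult.assoc[symmetric] scal_mult[symmetric])
  then show ?thesis using assms(2) by metis
qed

lemma tr_0 [simp]: "tr 0 = 0" and tr_1 [simp]: "tr 1 = 3"
  by (simp_all add: zero_mat3_def one_mat3_def)

lemma tr_scal [simp]: "tr (scal c) = 3 * c"
  by (simp add: scal_def)

lemma tr_add [simp]: "tr (x + y) = tr x + tr y"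
  and tr_diff [simp]: "tr (x - y) = tr x - tr y"
  by (cases x; cases y; simp)+

lemma tr_minus [simp]: "tr (- x) = - tr x"
  by (cases x) simp

lemma tr_scal_mult [simp]: "tr (scal c * x) = c * tr x"
  by (cases x) (simp add: scal_def algebra_simps)

lemma tr_mult_commute: "tr (x * y) = tr (y * x)"
  by (cases x; cases y) (simp add: algebra_simps)

text \<open>Pairing with the matrix units reads off the entries of \<open>x\<close>.\<close>

lemma tr_nondegenerate:
  assumes "\<And>y. tr (x * y) = 0"
  shows "x = 0"
proof (cases x)
  case (Mat a b c d e f g h i)
  show ?thesis
    using assms[of "Mat 1 0 0 0 0 0 0 0 0"] assms[of "Mat 0 1 0 0 0 0 0 0 0"]
      assms[of "Mat 0 0 1 0 0 0 0 0 0"] assms[of "Mat 0 0 0 1 0 0 0 0 0"]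
      assms[of "Mat 0 0 0 0 1 0 0 0 0"] assms[of "Mat 0 0 0 0 0 1 0 0 0"]
      assms[of "Mat 0 0 0 0 0 0 1 0 0"] assms[of "Mat 0 0 0 0 0 0 0 1 0"]
      assms[of "Mat 0 0 0 0 0 0 0 0 1"]
    by (simp add: Mat zero_mat3_def)
qed

lemma cayley_hamilton: "x * x * x = scal (tr x) * (x * x) - scal (minor_sum x) * x + scal (det3 x)"
  by (cases x) (simp add: scal_def algebra_simps)

text \<open>The part of \<open>cayley_hamilton\<close> for \<open>a + b + c\<close> that is linear
  in each of the three. On traceless matrices \<open>minor_sum\<close> polarizes to
  \<open>- tr (a * b)\<close>, so no denominators arise.\<close>

lemma polarized_cayley_hamilton:
  assumes "tr a = 0" "tr b = 0" "tr c = 0"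
  shows "a*b*c + a*c*b + b*a*c + b*c*a + c*a*b + c*b*a =
    scal (tr (a*b)) * c + scal (tr (a*c)) * b + scal (tr (b*c)) * a + scal (tr (a*b*c) + tr (a*c*b))"
proof (cases a; cases b; cases c)
  fix a1 a2 a3 a4 a5 a6 a7 a8 a9 b1 b2 b3 b4 b5 b6 b7 b8 b9 c1 c2 c3 c4 c5 c6 c7 c8 c9
  assume m: "a = Mat a1 a2 a3 a4 a5 a6 a7 a8 a9" "b = Mat b1 b2 b3 b4 b5 b6 b7 b8 b9"
    "c = Mat c1 c2 c3 c4 c5 c6 c7 c8 c9"
  have t: "a9 = - a1 - a5" "b9 = - b1 - b5" "c9 = - c1 - c5"
    using assms by (auto simp: m add_eq_0_iff)
  show ?thesis unfolding m t
    by (simp add: scal_def algebra_simps)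
qed

lemma det3_mult: "det3 (x * y) = det3 x * det3 y"
  by (cases x; cases y) (simp add: algebra_simps)

fun adj :: "'a::comm_ring_1 mat3 \<Rightarrow> 'a mat3" where
  "adj (Mat a b c d e f g h i) =
     Mat (e*i - f*h) (c*h - b*i) (b*f - c*e)
         (f*g - d*i) (a*i - c*g) (c*d - a*f)
         (d*h - e*g) (b*g - a*h) (a*e - b*d)"

lemma mult_adj: "x * adj x = scal (det3 x)"
  by (cases x) (simp add: scal_def algebra_simps)

lemma adj_mult: "adj x * x = scal (det3 x)"
  by (cases x) (simp add: scal_def algebra_simps)

text \<open>This makes the adjugate a polynomial in \<open>x\<close>: it stays in any subspace that
  contains \<open>x\<close> and the scalars and is closed under products.\<close>

lemma adj_eq: "adj x = x * x - scal (tr x) * x + scal (minor_sum x)"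
  by (cases x) (simp add: scal_def algebra_simps)

lemma tr_adj: "tr (adj x) = minor_sum x"
  by (cases x) (simp add: algebra_simps)

lemma mat3_left_inverse_imp_right_inverse:
  fixes p q :: "'a::field mat3"
  assumes "q * p = 1"
  shows "p * q = 1"
proof -
  have "det3 q * det3 p = 1"
    using assms by (simp add: det3_mult[symmetric] one_mat3_def)
  then have "det3 q \<noteq> 0" by auto
  have "scal (det3 q) * p = adj q * (q * p)"
    by (simp add: mult.assoc[symmetric] adj_mult)
  then have "scal (det3 q) * (p * q) = scal (det3 q) * 1"
    by (simp add: assms adj_mult flip: mult.assoc)
  then show ?thesis using \<open>det3 q \<noteq> 0\<close> by (rule scal_left_cancel[rotated])
qed

section \<open>The matrix model of the pseudo-octonion algebra\<close>

lemma three_arith [simp]: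
  "(1::3) + 1 = 2" "(1::3) + 2 = 0" "(2::3) + 1 = 0" "(2::3) + 2 = 1"
  "(1::3) \<noteq> 0" "(2::3) \<noteq> 0" "(2::3) \<noteq> 1" "(0::3) \<noteq> 1" "(0::3) \<noteq> 2" "(1::3) \<noteq> 2"
  by simp_all

lemma three_eq_zero: "(3::3) = 0"
  by simp

lemma exhaust_012: "(i::3) = 0 \<or> i = 1 \<or> i = 2"
  using exhaust_3[of i] by auto

lemma sum_012: "sum f (UNIV::3 set) = f 0 + f 1 + f 2"
  by (simp add: sum_3 three_eq_zero ac_simps)

lemma UNIV_cayley_basis: "(UNIV :: cayley_basis set) = {E1, E2, U 0, U 1, U 2, V 0, V 1, V 2}"
proof -
  have "b \<in> {E1, E2, U 0, U 1, U 2, V 0, V 1, V 2}" for b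
    using exhaust_012 by (cases b) auto
  then show ?thesis by blast
qed

lemma sum_cayley_basis:
  "sum f (UNIV :: cayley_basis set) =
     f E1 + f E2 + f (U 0) + f (U 1) + f (U 2) + f (V 0) + f (V 1) + f (V 2)"
  unfolding UNIV_cayley_basis by (simp add: ac_simps)

lemma all_cayley_basis:
  "(\<forall>b. P b) \<longleftrightarrow>
     P E1 \<and> P E2 \<and> P (U 0) \<and> P (U 1) \<and> P (U 2) \<and> P (V 0) \<and> P (V 1) \<and> P (V 2)"
proof -
  have "(\<forall>b. P b) \<longleftrightarrow> (\<forall>b \<in> {E1, E2, U 0, U 1, U 2, V 0, V 1, V 2}. P b)"
    unfolding UNIV_cayley_basis[symmetric] by simp
  then show ?thesis by simp
qed

lemma bas_nth: "bas b $ c = (if c = b then 1 else 0)"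
  by (simp add: bas_def axis_def)

lemma bilinear_ext_nth: "bilinear_ext t x y $ c = (\<Sum>a\<in>UNIV. \<Sum>b\<in>UNIV. x $ a * y $ b * t a b $ c)"
  by (simp add: bilinear_ext_def)

lemma linear_ext_nth: "linear_ext f x $ c = (\<Sum>a\<in>UNIV. x $ a * f a $ c)"
  by (simp add: linear_ext_def)

lemma cayley_mult_nth:
  "cayley_mult x y $ E1 = x $ E1 * y $ E1 - x $ U 0 * y $ V 0 - x $ U 1 * y $ V 1 - x $ U 2 * y $ V 2"
  "cayley_mult x y $ E2 = x $ E2 * y $ E2 - x $ V 0 * y $ U 0 - x $ V 1 * y $ U 1 - x $ V 2 * y $ U 2"
  "cayley_mult x y $ U 0 = x $ E1 * y $ U 0 + x $ U 0 * y $ E2 + x $ V 1 * y $ V 2 - x $ V 2 * y $ V 1"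
  "cayley_mult x y $ U 1 = x $ E1 * y $ U 1 + x $ U 1 * y $ E2 + x $ V 2 * y $ V 0 - x $ V 0 * y $ V 2"
  "cayley_mult x y $ U 2 = x $ E1 * y $ U 2 + x $ U 2 * y $ E2 + x $ V 0 * y $ V 1 - x $ V 1 * y $ V 0"
  "cayley_mult x y $ V 0 = x $ E2 * y $ V 0 + x $ V 0 * y $ E1 + x $ U 1 * y $ U 2 - x $ U 2 * y $ U 1"
  "cayley_mult x y $ V 1 = x $ E2 * y $ V 1 + x $ V 1 * y $ E1 + x $ U 2 * y $ U 0 - x $ U 0 * y $ U 2"
  "cayley_mult x y $ V 2 = x $ E2 * y $ V 2 + x $ V 2 * y $ E1 + x $ U 0 * y $ U 1 - x $ U 1 * y $ U 0"
  by (simp_all add: cayley_mult_def bilinear_ext_nth sum_cayley_basis bas_nth)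

lemma conjugation_nth:
  "conjugation cayley_norm cayley_one x $ E1 = x $ E2"
  "conjugation cayley_norm cayley_one x $ E2 = x $ E1"
  "conjugation cayley_norm cayley_one x $ U i = - x $ U i"
  "conjugation cayley_norm cayley_one x $ V i = - x $ V i"
  by (simp_all add: conjugation_def polar_def cayley_norm_def cayley_one_def sum_012 bas_nth algebra_simps)

lemma tau_st_nth:
  "tau_st x $ E1 = x $ E1" "tau_st x $ E2 = x $ E2"
  "tau_st x $ U 0 = x $ U 2" "tau_st x $ U 1 = x $ U 0" "tau_st x $ U 2 = x $ U 1"
  "tau_st x $ V 0 = x $ V 2" "tau_st x $ V 1 = x $ V 0" "tau_st x $ V 2 = x $ V 1"
  by (simp_all add: tau_st_def linear_ext_nth sum_cayley_basis bas_nth)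

lemma tau_omega_nth:
  "tau_omega w x $ E1 = x $ E1" "tau_omega w x $ E2 = x $ E2"
  "tau_omega w x $ U 0 = w ^ 3 * x $ U 0" "tau_omega w x $ U 1 = w * x $ U 1"
  "tau_omega w x $ U 2 = w ^ 2 * x $ U 2"
  "tau_omega w x $ V 0 = inverse (w ^ 3) * x $ V 0" "tau_omega w x $ V 1 = inverse w * x $ V 1"
  "tau_omega w x $ V 2 = inverse (w ^ 2) * x $ V 2"
  by (simp_all add: tau_omega_def linear_ext_nth sum_cayley_basis bas_nth index_power_def ac_simps)

text \<open>The last coefficient is forced by trace zero: \<open>w xy - w^2 yx\<close> has trace
  \<open>(w - w^2) tr (xy)\<close>, and the identity matrix has trace 3.\<close>

definition okubo_prod :: "'k::field \<Rightarrow> 'k mat3 \<Rightarrow> 'k mat3 \<Rightarrow> 'k mat3" where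
  "okubo_prod w x y =
     scal w * (x * y) - scal (w ^ 2) * (y * x) - scal ((w - w ^ 2) / 3 * tr (x * y))"

text \<open>Any two algebras with such a map for the same \<open>w\<close> are isomorphic, even with
  a conjugation of matrices inserted in between; see \<open>algebra_iso_of_models\<close>.\<close>

definition sl3_model ::
    "'k::field \<Rightarrow> ('k ^ 'b::finite \<Rightarrow> 'k ^ 'b \<Rightarrow> 'k ^ 'b) \<Rightarrow> ('k ^ 'b \<Rightarrow> 'k mat3) \<Rightarrow> bool" where
  "sl3_model w m \<Theta> \<longleftrightarrow>
     (\<forall>x y. \<Theta> (x + y) = \<Theta> x + \<Theta> y) \<and> (\<forall>c x. \<Theta> (c *s x) = scal c * \<Theta> x) \<and>
     inj \<Theta> \<and> range \<Theta> = {x. tr x = 0} \<and>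
     (\<forall>x y. \<Theta> (m x y) = okubo_prod w (\<Theta> x) (\<Theta> y))"

text \<open>Used as a rewrite rule, the quadratic equation reduces every polynomial in
  \<open>w\<close> to degree at most one. Together with \<open>3 \<noteq> 0\<close> it makes
  \<open>w\<close> a primitive cube root of 1.\<close>

locale cube_root =
  fixes w :: "'k::field"
  assumes w_square: "w * w = - 1 - w" and three_nz: "(3::'k) \<noteq> 0"
begin

lemma w_cube: "w * (w * w) = 1"
  by (simp add: w_square algebra_simps)

lemma w_square': "w * (w * x) = - x - w * x"
  by (simp add: w_square algebra_simps flip: mult.assoc)

lemma w_neq_one: "w \<noteq> 1"
proof
  assume "w = 1"
  then have "(1::'k) + 1 + 1 = 0" using w_square by simp
  then show False using three_nz by simp
qed

lemma inverse_w: "inverse w = - 1 - w"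
  using w_cube by (metis inverse_unique w_square)

lemma w_powers: "w ^ 2 = - 1 - w" "w ^ 3 = 1"
  by (simp add: power2_eq_square w_square) (simp add: power3_eq_cube w_cube mult.assoc)

definition r :: 'k where "r = (w - w ^ 2) / 3"

lemma okubo_prod_eq:
  "okubo_prod w x y = scal w * (x * y) - scal (- 1 - w) * (y * x) - scal (r * tr (x * y))"
  by (simp add: okubo_prod_def r_def w_powers)

lemma three_r: "3 * r = 2 * w + 1"
  using three_nz by (simp add: r_def w_powers)

text \<open>This is \<open>w - w^2\<close>, a square root of \<open>- 3\<close>. Hence
  \<open>r = s / 3 = - 1 / s\<close>, and the denominators in the coordinate identities are powers
  of \<open>s\<close>.\<close>

definition s :: 'k where "s = 2 * w + 1"

lemma s_square: "s * s = - 3"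
  by (simp add: s_def algebra_simps w_square w_square')

lemma s_nz: "s \<noteq> 0"
  using s_square three_nz by auto

lemma r_eq: "r = - 1 / s"
proof -
  have "s * (r * s) = s * (- 1)"
    using three_r unfolding mult.left_commute[of s] s_square by (simp add: s_def algebra_simps)
  then have "r * s = - 1" using s_nz by (metis mult_left_cancel)
  then show ?thesis using s_nz by (simp add: field_simps)
qed

lemma inverse_w': "inverse (- 1 - w) = w"
  using inverse_w by (metis inverse_inverse_eq)

text \<open>The elements \<open>e\<^sub>1, e\<^sub>2\<close> go to multiples of \<open>diag(1, w, w\<^sup>2)\<close> and of its inverse, and \<open>u\<^sub>i, v\<^sub>i\<close> to matrix
  units up to sign.\<close>

fun cayley_omega_model :: "'k ^ cayley_basis \<Rightarrow> 'k mat3" where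
  "cayley_omega_model x =
     (let a = - r * x $ E1; b = - r * x $ E2 in
      Mat (a + b) (- x $ V 2) (x $ U 1)
          (x $ U 2) (w * a + w ^ 2 * b) (- x $ V 0)
          (- x $ V 1) (x $ U 0) (w ^ 2 * a + w * b))"

text \<open>An identity in each matrix entry. The simplifier reduces powers of \<open>w\<close>,
  replaces \<open>r\<close> by \<open>- 1 / s\<close>, clears denominators and then reduces in
  \<open>w\<close> again; the other coordinate computations follow this scheme.\<close>

lemma cayley_omega_model_mult:
  "cayley_omega_model (cayley_omega_mult w x y)
     = okubo_prod w (cayley_omega_model x) (cayley_omega_model y)"
  by (simp add: Let_def okubo_prod_eq cayley_omega_mult_def petersson_def cayley_mult_nth
        tau_omega_nth conjugation_nth scal_def inverse_w inverse_w' w_powers, intro conjI,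
      simp_all add: algebra_simps w_square w_square', simp_all add: r_eq,
      simp_all add: field_simps s_nz, simp_all add: s_def algebra_simps w_square w_square' power_numeral_reduce)

text \<open>A discrete Fourier transform diagonalizes \<open>tau_st\<close>. Its matrix on the \<open>u\<^sub>i\<close> is scaled by \<open>- r\<close>, the
  inverse of \<open>w - w\<^sup>2\<close>, because the determinant of \<open>(w\<^bsup>ij\<^esup>)\<close> is \<open>(w - w\<^sup>2)\<^sup>3\<close>; thus the scaled matrix
  has determinant one and extends to an automorphism of the Cayley algebra.\<close>

definition st_to_omega :: "'k ^ cayley_basis \<Rightarrow> 'k ^ cayley_basis" where
  "st_to_omega x = (\<chi> b. case b of E1 \<Rightarrow> x $ E1 | E2 \<Rightarrow> x $ E2
     | U i \<Rightarrow> - r * (x $ U 0 + index_power w i * x $ U 1 + (index_power w i)^2 * x $ U 2)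
     | V i \<Rightarrow> r * (x $ V 0 + (index_power w i)^2 * x $ V 1 + index_power w i * x $ V 2))"

lemma st_to_omega_nth:
  "st_to_omega x $ E1 = x $ E1" "st_to_omega x $ E2 = x $ E2"
  "st_to_omega x $ U 0 = - r * (x $ U 0 + x $ U 1 + x $ U 2)"
  "st_to_omega x $ U 1 = - r * (x $ U 0 + w * x $ U 1 + (- 1 - w) * x $ U 2)"
  "st_to_omega x $ U 2 = - r * (x $ U 0 + (- 1 - w) * x $ U 1 + w * x $ U 2)"
  "st_to_omega x $ V 0 = r * (x $ V 0 + x $ V 1 + x $ V 2)"
  "st_to_omega x $ V 1 = r * (x $ V 0 + (- 1 - w) * x $ V 1 + w * x $ V 2)"
  "st_to_omega x $ V 2 = r * (x $ V 0 + w * x $ V 1 + (- 1 - w) * x $ V 2)"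
  by (simp_all add: st_to_omega_def index_power_def w_powers)
     (simp_all add: power2_eq_square w_square algebra_simps w_square')

lemma st_to_omega_mult:
  "st_to_omega (pseudo_octonion_mult x y) = cayley_omega_mult w (st_to_omega x) (st_to_omega y)"
proof -
  have "\<forall>b. st_to_omega (pseudo_octonion_mult x y) $ b
      = cayley_omega_mult w (st_to_omega x) (st_to_omega y) $ b"
    unfolding all_cayley_basis
    by (simp_all add: pseudo_octonion_mult_def cayley_omega_mult_def petersson_def cayley_mult_nth
          tau_omega_nth conjugation_nth tau_st_nth inverse_w inverse_w' w_powers st_to_omega_nth,
        intro conjI, simp_all add: algebra_simps w_square w_square', simp_all add: r_eq,
        simp_all add: field_simps s_nz, simp_all add: s_def algebra_simps w_square w_square' power_numeral_reduce)
  then show ?thesis by (simp add: vec_eq_iff)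
qed


lemma cayley_omega_model_linear:
  "cayley_omega_model (x + y) = cayley_omega_model x + cayley_omega_model y"
  "cayley_omega_model (c *s x) = scal c * cayley_omega_model x"
  by (simp_all add: Let_def scal_def algebra_simps)

lemma cayley_omega_model_tr: "tr (cayley_omega_model x) = 0"
  by (simp add: Let_def algebra_simps w_powers)

lemma vec_cayley_basis_eqI:
  fixes x y :: "'k ^ cayley_basis"
  assumes "x $ E1 = y $ E1" "x $ E2 = y $ E2" "x $ U 0 = y $ U 0" "x $ U 1 = y $ U 1"
    "x $ U 2 = y $ U 2" "x $ V 0 = y $ V 0" "x $ V 1 = y $ V 1" "x $ V 2 = y $ V 2"
  shows "x = y"
  unfolding vec_eq_iff all_cayley_basis using assms by simp

text \<open>The diagonal of the model is a Fourier transform of the coordinates at \<open>E1\<close>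
  and \<open>E2\<close>. Inverting it produces a factor 3, which is absorbed because
  \<open>- 3 * r ^ 2 = 1\<close>.\<close>

fun cayley_omega_coords :: "'k mat3 \<Rightarrow> 'k ^ cayley_basis" where
  "cayley_omega_coords (Mat a b c d e f g h i) =
     (\<chi> z. if z = E1 then r * (a + w ^ 2 * e + w * i) else if z = E2 then r * (a + w * e + w ^ 2 * i)
       else if z = U 0 then h else if z = U 1 then c else if z = U 2 then d
       else if z = V 0 then - f else if z = V 1 then - g else - b)"

lemma cayley_omega_coords_model: "cayley_omega_coords (cayley_omega_model x) = x"
  by (rule vec_cayley_basis_eqI)
     (simp_all add: Let_def w_powers algebra_simps w_square w_square', simp_all add: r_eq,
      simp_all add: field_simps s_nz, simp_all add: s_def algebra_simps w_square w_square')

lemma cayley_omega_model_coords: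
  assumes "tr M = 0"
  shows "cayley_omega_model (cayley_omega_coords M) = M"
proof (cases M)
  case (Mat a b c d e f g h i)
  have i: "i = - a - e" using assms by (auto simp: Mat add_eq_0_iff)
  show ?thesis unfolding Mat i
    by (simp add: Let_def w_powers algebra_simps w_square w_square', intro conjI, simp_all add: r_eq,
      simp_all add: field_simps s_nz, simp_all add: s_def algebra_simps w_square w_square')
qed

lemma sl3_model_cayley_omega: "sl3_model w (cayley_omega_mult w) cayley_omega_model"
  unfolding sl3_model_def
proof (intro conjI allI)
  show "inj cayley_omega_model"
    by (rule inj_on_inverseI[of _ cayley_omega_coords]) (rule cayley_omega_coords_model)
  show "range cayley_omega_model = {x. tr x = 0}"
  proof (intro equalityI subsetI)
    fix M :: "'k mat3"
    assume "M \<in> {x. tr x = 0}"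
    then show "M \<in> range cayley_omega_model"
      using cayley_omega_model_coords by (intro range_eqI[of _ _ "cayley_omega_coords M"]) simp
  qed (use cayley_omega_model_tr in blast)
qed (simp_all only: cayley_omega_model_linear cayley_omega_model_mult)

text \<open>The conjugate Fourier matrices. Composed with those of \<open>st_to_omega\<close> they
  give \<open>3 * (- r * r) = 1\<close> times the identity.\<close>

definition omega_to_st :: "'k ^ cayley_basis \<Rightarrow> 'k ^ cayley_basis" where
  "omega_to_st x = (\<chi> b. case b of E1 \<Rightarrow> x $ E1 | E2 \<Rightarrow> x $ E2
     | U i \<Rightarrow> r * (x $ U 0 + (index_power w i)^2 * x $ U 1 + index_power w i * x $ U 2)
     | V i \<Rightarrow> - r * (x $ V 0 + index_power w i * x $ V 1 + (index_power w i)^2 * x $ V 2))"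

lemma omega_to_st_nth:
  "omega_to_st x $ E1 = x $ E1" "omega_to_st x $ E2 = x $ E2"
  "omega_to_st x $ U 0 = r * (x $ U 0 + x $ U 1 + x $ U 2)"
  "omega_to_st x $ U 1 = r * (x $ U 0 + (- 1 - w) * x $ U 1 + w * x $ U 2)"
  "omega_to_st x $ U 2 = r * (x $ U 0 + w * x $ U 1 + (- 1 - w) * x $ U 2)"
  "omega_to_st x $ V 0 = - r * (x $ V 0 + x $ V 1 + x $ V 2)"
  "omega_to_st x $ V 1 = - r * (x $ V 0 + w * x $ V 1 + (- 1 - w) * x $ V 2)"
  "omega_to_st x $ V 2 = - r * (x $ V 0 + (- 1 - w) * x $ V 1 + w * x $ V 2)"
  by (simp_all add: omega_to_st_def index_power_def w_powers)
     (simp_all add: power2_eq_square w_square algebra_simps w_square')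

lemma omega_to_st_to_omega: "st_to_omega (omega_to_st x) = x"
  by (rule vec_cayley_basis_eqI)
     (simp_all only: st_to_omega_nth omega_to_st_nth, simp_all add: r_eq, simp_all add: field_simps s_nz,
      simp_all add: s_def algebra_simps w_square w_square')

lemma st_to_omega_to_st: "omega_to_st (st_to_omega x) = x"
  by (rule vec_cayley_basis_eqI)
     (simp_all only: st_to_omega_nth omega_to_st_nth, simp_all add: r_eq, simp_all add: field_simps s_nz,
      simp_all add: s_def algebra_simps w_square w_square')

lemma st_to_omega_linear:
  "st_to_omega (x + y) = st_to_omega x + st_to_omega y" "st_to_omega (c *s x) = c *s st_to_omega x"
  by (rule vec_cayley_basis_eqI; simp add: st_to_omega_nth algebra_simps)+

lemma sl3_model_pseudo_octonion:
  "sl3_model w pseudo_octonion_mult (\<lambda>x. cayley_omega_model (st_to_omega x))"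
proof -
  have "inj (\<lambda>x. cayley_omega_model (st_to_omega x))"
    by (rule inj_on_inverseI[of _ "\<lambda>M. omega_to_st (cayley_omega_coords M)"])
       (simp only: cayley_omega_coords_model st_to_omega_to_st)
  moreover have "range (\<lambda>x. cayley_omega_model (st_to_omega x)) = range cayley_omega_model"
  proof -
    have "y \<in> range (\<lambda>x. cayley_omega_model (st_to_omega x))" if "y = cayley_omega_model z" for y z
      by (rule range_eqI[of _ _ "omega_to_st z"]) (simp only: that omega_to_st_to_omega)
    then show ?thesis by blast
  qed
  ultimately show ?thesis
    using sl3_model_cayley_omega unfolding sl3_model_def
    by (auto simp add: st_to_omega_linear st_to_omega_mult simp del: cayley_omega_model.simps)
qed

end

section \<open>The matrix model of the Okubo algebras\<close>

lemma sum_okubo_basis: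
  "sum f (UNIV :: okubo_basis set) =
     f X_PZ + f X_MZ + f X_ZP + f X_ZM + f X_PP + f X_MM + f X_MP + f X_PM"
proof -
  have "(UNIV :: okubo_basis set) = {X_PZ, X_MZ, X_ZP, X_ZM, X_PP, X_MM, X_MP, X_PM}"
    using okubo_basis.exhaust by blast
  then have "sum f UNIV = sum f {X_PZ, X_MZ, X_ZP, X_ZM, X_PP, X_MM, X_MP, X_PM}"
    by (rule arg_cong)
  then show ?thesis by (simp add: ac_simps)
qed

lemma okubo_mult_nth:
  "okubo_mult a b x y $ X_PZ = - inverse a * (x $ X_MZ * y $ X_MZ) + x $ X_ZP * y $ X_PM
     + x $ X_PP * y $ X_ZM + inverse a * (x $ X_MP * y $ X_MM)"
  "okubo_mult a b x y $ X_MZ = - a * (x $ X_PZ * y $ X_PZ) + x $ X_ZM * y $ X_MP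
     + x $ X_MM * y $ X_ZP + a * (x $ X_PM * y $ X_PP)"
  "okubo_mult a b x y $ X_ZP = x $ X_MZ * y $ X_PP - inverse b * (x $ X_ZM * y $ X_ZM)
     + inverse b * (x $ X_MM * y $ X_PM) + x $ X_MP * y $ X_PZ"
  "okubo_mult a b x y $ X_ZM = x $ X_PZ * y $ X_MM - b * (x $ X_ZP * y $ X_ZP)
     + b * (x $ X_PP * y $ X_MP) + x $ X_PM * y $ X_MZ"
  "okubo_mult a b x y $ X_PP = inverse a * (x $ X_MZ * y $ X_MP) + x $ X_ZP * y $ X_PZ
     - inverse (a * b) * (x $ X_MM * y $ X_MM) + inverse b * (x $ X_PM * y $ X_ZM)"
  "okubo_mult a b x y $ X_MM = a * (x $ X_PZ * y $ X_PM) + x $ X_ZM * y $ X_MZ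
     - a * b * (x $ X_PP * y $ X_PP) + b * (x $ X_MP * y $ X_ZP)"
  "okubo_mult a b x y $ X_MP = x $ X_MZ * y $ X_ZP + inverse b * (x $ X_ZM * y $ X_MM)
     + a * (x $ X_PP * y $ X_PZ) - a * inverse b * (x $ X_PM * y $ X_PM)"
  "okubo_mult a b x y $ X_PM = x $ X_PZ * y $ X_ZM + b * (x $ X_ZP * y $ X_PP)
     + inverse a * (x $ X_MM * y $ X_MZ) - inverse a * b * (x $ X_MP * y $ X_MP)"
  by (simp_all add: okubo_mult_def bilinear_ext_nth sum_okubo_basis bas_nth)

lemma vec_okubo_basis_eqI:
  fixes x y :: "'k ^ okubo_basis"
  assumes "x $ X_PZ = y $ X_PZ" "x $ X_MZ = y $ X_MZ" "x $ X_ZP = y $ X_ZP" "x $ X_ZM = y $ X_ZM"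
    "x $ X_PP = y $ X_PP" "x $ X_MM = y $ X_MM" "x $ X_MP = y $ X_MP" "x $ X_PM = y $ X_PM"
  shows "x = y"
proof -
  have "x $ b = y $ b" for b using assms by (cases b) simp_all
  then show ?thesis by (simp add: vec_eq_iff)
qed

text \<open>A factor \<open>\<alpha>\<close> or \<open>\<beta>\<close>, or its inverse, enters the
  table exactly when the corresponding sum of indices leaves the range from -1 to 1 and wraps by 3.
  For \<open>\<alpha> = a ^ 3\<close> and \<open>\<beta> = b ^ 3\<close> the weights
  \<open>a ^ i * b ^ j\<close> therefore remove all these factors.\<close>

definition okubo_rescale :: "'k::field \<Rightarrow> 'k \<Rightarrow> 'k ^ okubo_basis \<Rightarrow> 'k ^ okubo_basis" where
  "okubo_rescale a b x =
     (\<chi> z. a powi fst (okubo_index z) * b powi snd (okubo_index z) * x $ z)"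

lemma okubo_rescale_mult:
  assumes "a \<noteq> 0" "b \<noteq> 0"
  shows "okubo_rescale a b (okubo_mult (a ^ 3) (b ^ 3) x y)
    = okubo_mult 1 1 (okubo_rescale a b x) (okubo_rescale a b y)"
  using assms
  by (intro vec_okubo_basis_eqI)
     (simp_all add: okubo_rescale_def okubo_mult_nth power_int_minus field_simps power3_eq_cube)

lemma okubo_rescale_linear:
  "okubo_rescale a b (x + y) = okubo_rescale a b x + okubo_rescale a b y"
  "okubo_rescale a b (c *s x) = c *s okubo_rescale a b x"
  by (simp_all add: okubo_rescale_def vec_eq_iff algebra_simps)

lemma okubo_rescale_inverse:
  assumes "a \<noteq> 0" "b \<noteq> 0"
  shows "okubo_rescale (inverse a) (inverse b) (okubo_rescale a b x) = x"
  using assms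
  by (intro vec_okubo_basis_eqI) (simp_all add: okubo_rescale_def power_int_minus field_simps)

context cube_root
begin

text \<open>This maps \<open>x\<^bsub>i,j\<^esub>\<close> to \<open>r w\<^bsup>ij\<^esup> X\<^sup>i Y\<^sup>j\<close>, where \<open>X = diag(1, w, w\<^sup>2)\<close> and \<open>Y\<close> shifts the standard basis
  cyclically, so that \<open>X Y = w Y X\<close>.\<close>

fun okubo_model :: "'k ^ okubo_basis \<Rightarrow> 'k mat3" where
  "okubo_model x =
     (let p = r * x $ X_PZ; m = r * x $ X_MZ; z = r * x $ X_ZP; z' = r * x $ X_ZM;
          q = r * w * x $ X_PP; n = r * w ^ 2 * x $ X_MP;
          q' = r * w ^ 2 * x $ X_PM; n' = r * w * x $ X_MM in
      Mat (p + m) (z' + q' + n') (z + q + n)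
          (z + w * q + w ^ 2 * n) (w * p + w ^ 2 * m) (z' + w * q' + w ^ 2 * n')
          (z' + w ^ 2 * q' + w * n') (z + w ^ 2 * q + w * n) (w ^ 2 * p + w * m))"

text \<open>Entries are named by cyclic diagonals: \<open>d\<close> carries the powers of
  \<open>X\<close>, \<open>f\<close> those times \<open>Y\<close>, and \<open>g\<close> those times
  the inverse of \<open>Y\<close>. Each diagonal is inverted by a Fourier transform, and the
  prefactor is \<open>- r\<close> because \<open>- r * (3 * r) = 1\<close>.\<close>

fun okubo_coords :: "'k mat3 \<Rightarrow> 'k ^ okubo_basis" where
  "okubo_coords (Mat d0 g0 f0 f1 d1 g1 g2 f2 d2) = - r *s (\<chi> b. case b of
     X_PZ \<Rightarrow> d0 + w ^ 2 * d1 + w * d2 | X_MZ \<Rightarrow> d0 + w * d1 + w ^ 2 * d2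
   | X_ZP \<Rightarrow> f0 + f1 + f2 | X_ZM \<Rightarrow> g0 + g1 + g2
   | X_PP \<Rightarrow> w ^ 2 * (f0 + w ^ 2 * f1 + w * f2) | X_MP \<Rightarrow> w * (f0 + w * f1 + w ^ 2 * f2)
   | X_PM \<Rightarrow> w * (g0 + w ^ 2 * g1 + w * g2) | X_MM \<Rightarrow> w ^ 2 * (g0 + w * g1 + w ^ 2 * g2))"

lemma okubo_model_mult:
  "okubo_model (okubo_mult 1 1 x y) = okubo_prod w (okubo_model x) (okubo_model y)"
  by (simp add: Let_def okubo_prod_eq okubo_mult_nth scal_def w_powers, intro conjI,
      simp_all add: algebra_simps w_square w_square', simp_all add: r_eq,
      simp_all add: field_simps s_nz, simp_all add: s_def algebra_simps w_square w_square')

lemma okubo_model_linear: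
  "okubo_model (x + y) = okubo_model x + okubo_model y"
  "okubo_model (c *s x) = scal c * okubo_model x"
  by (simp_all add: Let_def scal_def algebra_simps)

lemma okubo_model_tr: "tr (okubo_model x) = 0"
  by (simp add: Let_def algebra_simps w_powers)

lemma okubo_coords_model: "okubo_coords (okubo_model x) = x"
  by (rule vec_okubo_basis_eqI)
     (simp_all add: Let_def w_powers algebra_simps w_square w_square', simp_all add: r_eq,
      simp_all add: field_simps s_nz, simp_all add: s_def algebra_simps w_square w_square')

lemma okubo_model_coords:
  assumes "tr M = 0"
  shows "okubo_model (okubo_coords M) = M"
proof (cases M)
  case (Mat a b c d e f g h i)
  have i: "i = - a - e" using assms by (auto simp: Mat add_eq_0_iff)
  show ?thesis unfolding Mat i
    by (simp add: Let_def w_powers algebra_simps w_square w_square', intro conjI, simp_all add: r_eq,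
      simp_all add: field_simps s_nz, simp_all add: s_def algebra_simps w_square w_square')
qed

lemma sl3_model_okubo:
  assumes "a \<noteq> 0" "b \<noteq> 0"
  shows "sl3_model w (okubo_mult (a ^ 3) (b ^ 3)) (\<lambda>x. okubo_model (okubo_rescale a b x))"
proof -
  let ?f = "\<lambda>x. okubo_model (okubo_rescale a b x)"
  let ?g = "\<lambda>M. okubo_rescale (inverse a) (inverse b) (okubo_coords M)"
  have "inj ?f"
    by (rule inj_on_inverseI[of _ ?g]) (simp only: okubo_coords_model okubo_rescale_inverse[OF assms])
  moreover have "range ?f = {x. tr x = 0}"
  proof (intro equalityI subsetI)
    fix M :: "'k mat3"
    assume "M \<in> {x. tr x = 0}"
    then have "M = ?f (?g M)"
      using okubo_rescale_inverse[of "inverse a" "inverse b"] assms okubo_model_coords[of M] by simp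
    then show "M \<in> range ?f" by (rule range_eqI)
  qed (use okubo_model_tr in blast)
  moreover have "?f (okubo_mult (a ^ 3) (b ^ 3) x y) = okubo_prod w (?f x) (?f y)" for x y
    by (simp only: okubo_rescale_mult[OF assms] okubo_model_mult)
  moreover have "?f (x + y) = ?f x + ?f y" "?f (c *s x) = scal c * ?f x" for x y c
    by (simp_all only: okubo_rescale_linear okubo_model_linear)
  ultimately show ?thesis
    unfolding sl3_model_def by blast
qed

end

section \<open>Matrices of rank one\<close>

fun outer :: "'a::comm_ring_1 \<times> 'a \<times> 'a \<Rightarrow> 'a \<times> 'a \<times> 'a \<Rightarrow> 'a mat3" where
  "outer (a, b, c) (d, e, f) = Mat (a*d) (a*e) (a*f) (b*d) (b*e) (b*f) (c*d) (c*e) (c*f)"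

fun dot :: "'a::comm_ring_1 \<times> 'a \<times> 'a \<Rightarrow> 'a \<times> 'a \<times> 'a \<Rightarrow> 'a" where
  "dot (a, b, c) (d, e, f) = a*d + b*e + c*f"

fun cross :: "'a::comm_ring_1 \<times> 'a \<times> 'a \<Rightarrow> 'a \<times> 'a \<times> 'a \<Rightarrow> 'a \<times> 'a \<times> 'a" where
  "cross (a, b, c) (d, e, f) = (b*f - c*e, c*d - a*f, a*e - b*d)"

fun mv :: "'a::comm_ring_1 mat3 \<Rightarrow> 'a \<times> 'a \<times> 'a \<Rightarrow> 'a \<times> 'a \<times> 'a" where
  "mv (Mat a b c d e f g h i) (x, y, z) = (a*x + b*y + c*z, d*x + e*y + f*z, g*x + h*y + i*z)"

fun vm :: "'a::comm_ring_1 \<times> 'a \<times> 'a \<Rightarrow> 'a mat3 \<Rightarrow> 'a \<times> 'a \<times> 'a" where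
  "vm (x, y, z) (Mat a b c d e f g h i) = (x*a + y*d + z*g, x*b + y*e + z*h, x*c + y*f + z*i)"

fun column_mat where
  "column_mat (a, b, c) (d, e, f) (g, h, i) = Mat a d g b e h c f i"

fun row_mat where
  "row_mat (a, b, c) (d, e, f) (g, h, i) = Mat a b c d e f g h i"

lemma mult_outer: "x * outer v w = outer (mv x v) w"
  by (cases x; cases v; cases w) (simp add: algebra_simps)

lemma outer_mult: "outer v w * x = outer v (vm w x)"
  by (cases x; cases v; cases w) (simp add: algebra_simps)

lemma outer_mult_outer: "outer v w * outer v' w' = scal (dot w v') * outer v w'"
  by (cases v; cases w; cases v'; cases w') (simp add: scal_def algebra_simps)

lemma tr_outer: "tr (outer v w) = dot w v"
  by (cases v; cases w) (simp add: algebra_simps)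

lemma dot_vm: "dot (vm w x) v = dot w (mv x v)"
  by (cases v; cases w; cases x) (simp add: algebra_simps)

lemma dot_commute: "dot v w = dot w v"
  by (cases v; cases w) (simp add: algebra_simps)

lemma mv_mult: "mv (x * y) v = mv x (mv y v)"
  by (cases v; cases y; cases x) (simp add: algebra_simps)

lemma vm_mult: "vm v (x * y) = vm (vm v x) y"
  by (cases v; cases y; cases x) (simp add: algebra_simps)

lemma mv_one [simp]: "mv 1 v = v" and vm_one [simp]: "vm v 1 = v"
  by (cases v; simp add: one_mat3_def)+

text \<open>Scaling a triple is expressed as the action of a scalar matrix.\<close>

lemma mv_outer: "mv (outer v w) u = mv (scal (dot w u)) v"
  by (cases v; cases w; cases u) (simp add: scal_def algebra_simps)

lemma scal_mult_outer: "scal c * outer v w = outer v (vm w (scal c))"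
  by (cases v; cases w) (simp add: scal_def algebra_simps)

lemma dot_vm_scal [simp]: "dot (vm w (scal c)) v = c * dot w v"
  by (cases v; cases w) (simp add: scal_def algebra_simps)

lemma mult_column_mat: "x * column_mat u v w = column_mat (mv x u) (mv x v) (mv x w)"
  by (cases x; cases u; cases v; cases w) simp

lemma row_mat_mult_column_mat:
  "row_mat a b c * column_mat u v w = Mat (dot a u) (dot a v) (dot a w) (dot b u) (dot b v) (dot b w)
     (dot c u) (dot c v) (dot c w)"
  by (cases a; cases b; cases c; cases u; cases v; cases w) simp

lemma column_mat_mult_row_mat: "column_mat u v w * row_mat a b c = outer u a + outer v b + outer w c"
  by (cases a; cases b; cases c; cases u; cases v; cases w) simp

lemma dot_cross [simp]: "dot v (cross v w) = 0" "dot w (cross v w) = 0"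
    "dot (cross v w) v = 0" "dot (cross v w) w = 0"
  by (cases v; cases w; simp add: algebra_simps)+

lemma dot_cross_cross: "dot (cross a b) (cross c d) = dot a c * dot b d - dot a d * dot b c"
  by (cases a; cases b; cases c; cases d) (simp add: algebra_simps)

lemma adj_adj: "adj (adj x) = scal (det3 x) * x"
  by (cases x) (simp add: scal_def algebra_simps)

text \<open>Vanishing of the adjugate means that all 2 by 2 minors vanish, and the trace guarantees
  a nonzero diagonal entry. The column through that entry and the row through it, divided by the
  entry, are the two factors.\<close>

lemma rank_one_eq_outer:
  fixes x :: "'k::field mat3"
  assumes "adj x = 0" "tr x \<noteq> 0"
  obtains v w where "x = outer v w"
proof (cases x)
  case (Mat a b c d e f g h i)
  consider "a \<noteq> 0" | "e \<noteq> 0" | "i \<noteq> 0"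
    using assms(2) by (force simp: Mat)
  then show thesis
  proof cases
    case 1
    then have "x = outer (a, d, g) (1, b / a, c / a)"
      using assms(1) by (simp add: Mat zero_mat3_def field_simps)
    then show thesis by (rule that)
  next
    case 2
    then have "x = outer (b, e, h) (d / e, 1, f / e)"
      using assms(1) by (simp add: Mat zero_mat3_def field_simps)
    then show thesis by (rule that)
  next
    case 3
    then have "x = outer (c, f, i) (g / i, h / i, 1)"
      using assms(1) by (simp add: Mat zero_mat3_def field_simps)
    then show thesis by (rule that)
  qed
qed

text \<open>If \<open>x = z - c\<close> for a simple eigenvalue \<open>c\<close> of \<open>z\<close>, then the adjugate of \<open>x\<close> is a multiple of the
  projection to the eigenspace.\<close>

lemma simple_eigenvalue_projection:
  fixes x :: "'k::field mat3"
  assumes "det3 x = 0" "minor_sum x \<noteq> 0"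
  obtains v w where "adj x = scal (minor_sum x) * outer v w" "dot w v = 1"
proof -
  obtain v u where vu: "adj x = outer v u"
    by (rule rank_one_eq_outer[of "adj x"]) (use assms in \<open>simp_all add: adj_adj tr_adj\<close>)
  let ?w = "vm u (scal (inverse (minor_sum x)))"
  have "scal (minor_sum x) * outer v ?w = scal (minor_sum x * inverse (minor_sum x)) * outer v u"
    by (simp only: scal_mult mult.assoc scal_mult_outer[of _ v u, symmetric])
  then have "adj x = scal (minor_sum x) * outer v ?w"
    using assms(2) vu by simp
  moreover have "dot ?w v = 1"
    using assms(2) vu tr_adj[of x] by (simp add: tr_outer)
  ultimately show thesis by (rule that)
qed

lemma det3_diff_scal: "det3 (x - scal c) = det3 x - c * minor_sum x + c^2 * tr x - c^3"
  by (cases x) (simp add: scal_def algebra_simps power2_eq_square power3_eq_cube)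

text \<open>The right-hand side is the derivative of the characteristic polynomial at
  \<open>c\<close>; at an eigenvalue it is nonzero exactly when the eigenvalue is simple.\<close>

lemma minor_sum_diff_scal: "minor_sum (x - scal c) = minor_sum x - 2 * c * tr x + 3 * c^2"
  by (cases x) (simp add: scal_def algebra_simps power2_eq_square)

text \<open>The characteristic polynomial of a traceless matrix has this shape, without a quadratic
  term.\<close>

lemma cubic_root_exists: "\<exists>t :: 'k::alg_closed_field. t^3 + p * t + q = 0"
proof -
  let ?f = "\<lambda>n::nat. if n = 0 then q else if n = 1 then p else if n = 3 then 1 else 0"
  obtain t where "(\<Sum>n\<le>3. ?f n * t ^ n) = 0"
    using alg_closed[of 3 ?f] by auto
  then have "q + p * t + t ^ 3 = 0"
    by (simp add: eval_nat_numeral)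
  then show ?thesis by (metis add.assoc add.commute)
qed

section \<open>Gradings of the matrix algebra\<close>

definition unit1 :: "'k::comm_ring_1 \<times> 'k \<times> 'k" where "unit1 = (1, 0, 0)"
definition unit2 :: "'k::comm_ring_1 \<times> 'k \<times> 'k" where "unit2 = (0, 1, 0)"
definition unit3 :: "'k::comm_ring_1 \<times> 'k \<times> 'k" where "unit3 = (0, 0, 1)"

lemma sum_outer_eq_one: "outer unit1 unit1 + outer unit2 unit2 + outer unit3 unit3 = 1"
  by (simp add: unit1_def unit2_def unit3_def one_mat3_def)

lemma one_neq_outer: "1 \<noteq> outer v (w :: 'k::idom \<times> 'k \<times> 'k)"
  by (cases v; cases w) (auto simp: one_mat3_def)

lemma mv_column_mat [simp]: "mv (column_mat u v w) unit1 = u" "mv (column_mat u v w) unit2 = v" "mv (column_mat u v w) unit3 = w"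
  by (cases u; cases v; cases w; simp add: unit1_def unit2_def unit3_def)+

lemma vm_row_mat [simp]: "vm unit1 (row_mat u v w) = u" "vm unit2 (row_mat u v w) = v" "vm unit3 (row_mat u v w) = w"
  by (cases u; cases v; cases w; simp add: unit1_def unit2_def unit3_def)+

definition clock :: "'k::comm_ring_1 \<Rightarrow> 'k mat3" where
  "clock w = Mat 1 0 0 0 w 0 0 0 (w * w)"

definition shift :: "'k::comm_ring_1 mat3" where
  "shift = Mat 0 0 1 1 0 0 0 1 0"

lemma column_mat_mult_shift: "column_mat u v w * shift = column_mat v w u"
  by (cases u; cases v; cases w) (simp add: shift_def)

lemma column_mat_mult_clock: "column_mat u v x * clock w = column_mat u (mv (scal w) v) (mv (scal (w * w)) x)"
  by (cases u; cases v; cases x) (simp add: clock_def scal_def algebra_simps)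

lemma dot_mv_add: "dot w (mv (x + y) v) = dot w (mv x v) + dot w (mv y v)"
  by (cases w; cases v; cases x; cases y) (simp add: algebra_simps)

lemma dot_mv_outer: "dot a (mv (outer v w) b) = dot a v * dot w b"
  by (cases a; cases b; cases v; cases w) (simp add: algebra_simps)

lemma dot_mv_one_minus_outer: "dot a (mv (1 - outer v w) b) = dot a b - dot a v * dot w b"
  by (cases a; cases b; cases v; cases w) (simp add: one_mat3_def algebra_simps)

text \<open>Spanning is stated as the induction rule \<open>H_induct\<close>, so that an additive
  property of all matrices need only be checked on homogeneous ones. \<open>H_tr\<close> makes the
  components of degrees \<open>g\<close> and \<open>h\<close> orthogonal under the trace form unless
  \<open>g \<otimes> h = \<one>\<close>.\<close>

locale graded_mat3 = group G + cube_root w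
  for w :: "'k::alg_closed_field" and G (structure) +
  fixes H :: "'g \<Rightarrow> 'k mat3 set"
  assumes H_add: "\<lbrakk>g \<in> carrier G; x \<in> H g; y \<in> H g\<rbrakk> \<Longrightarrow> x + y \<in> H g"
    and H_scal: "\<lbrakk>g \<in> carrier G; x \<in> H g\<rbrakk> \<Longrightarrow> scal c * x \<in> H g"
    and one_in_H: "1 \<in> H \<one>"
    and H_mult: "\<lbrakk>g \<in> carrier G; h \<in> carrier G; x \<in> H g; y \<in> H h\<rbrakk> \<Longrightarrow> x * y \<in> H (g \<otimes> h)"
    and H_tr: "\<lbrakk>g \<in> carrier G; g \<noteq> \<one>; x \<in> H g\<rbrakk> \<Longrightarrow> tr x = 0"
    and H_comm: "\<lbrakk>g \<in> carrier G; h \<in> carrier G; x \<in> H g; y \<in> H h; x \<noteq> 0; y \<noteq> 0\<rbrakk>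
      \<Longrightarrow> g \<otimes> h = h \<otimes> g"
    and H_induct: "\<lbrakk>\<And>g x. g \<in> carrier G \<Longrightarrow> x \<in> H g \<Longrightarrow> P x; \<And>x y. P x \<Longrightarrow> P y \<Longrightarrow> P (x + y)\<rbrakk> \<Longrightarrow> P z"
begin

section \<open>Trace duality and rank-one idempotents in degree one\<close>

lemma scal_in_H: "scal c \<in> H \<one>"
  using H_scal[OF one_closed one_in_H] by simp

lemma H_diff: "\<lbrakk>g \<in> carrier G; x \<in> H g; y \<in> H g\<rbrakk> \<Longrightarrow> x - y \<in> H g"
  using H_add[of g x "scal (- 1) * y"] H_scal[of g y "- 1"] by (simp add: scal_minus)

lemma H_one_mult: "\<lbrakk>x \<in> H \<one>; y \<in> H \<one>\<rbrakk> \<Longrightarrow> x * y \<in> H \<one>"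
  using H_mult[of \<one> \<one> x y] by simp

text \<open>Since homogeneous elements span, nondegeneracy of the trace form is already witnessed by
  a homogeneous \<open>y\<close>; the nonzero trace then forces \<open>x * y\<close> into degree
  \<open>\<one>\<close>.\<close>

lemma H_dual:
  assumes "g \<in> carrier G" "x \<in> H g" "x \<noteq> 0"
  obtains h y where "h \<in> carrier G" "y \<in> H h" "tr (x * y) \<noteq> 0" "g \<otimes> h = \<one>" "h \<otimes> g = \<one>"
proof -
  have "\<exists>h y. h \<in> carrier G \<and> y \<in> H h \<and> tr (x * y) \<noteq> 0"
  proof (rule ccontr)
    assume neg: "\<not> ?thesis"
    have "tr (x * z) = 0" for z
      by (rule H_induct[of "\<lambda>z. tr (x * z) = 0"]) (use neg in \<open>auto simp: algebra_simps\<close>)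
    then show False using assms(3) tr_nondegenerate by blast
  qed
  then obtain h y where y: "h \<in> carrier G" "y \<in> H h" "tr (x * y) \<noteq> 0" by blast
  then have "g \<otimes> h = \<one>"
    using H_tr[of "g \<otimes> h" "x * y"] H_mult[of g h x y] assms by auto
  moreover have "h \<otimes> g = \<one>"
    using calculation assms y inv_equality[of g h] inv_comm by blast
  ultimately show thesis using that y by blast
qed

text \<open>Multiplying by the two idempotents on the left and on the right preserves degrees and
  maps every matrix to a multiple of \<open>outer v u'\<close>. As the homogeneous elements span,
  one of them has a nonzero image.\<close>

lemma unit_homogeneous:
  assumes "outer v v' \<in> H \<one>" "outer u u' \<in> H \<one>" "dot v' v = 1" "dot u' u = 1"
  shows "\<exists>g\<in>carrier G. outer v u' \<in> H g"
proof -
  let ?f = "\<lambda>x. outer v v' * x * outer u u'"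
  have f: "?f x = scal (dot v' (mv x u)) * outer v u'" for x
    by (simp only: outer_mult[of v v' x] outer_mult_outer dot_vm)
  have "\<exists>g x. g \<in> carrier G \<and> x \<in> H g \<and> dot v' (mv x u) \<noteq> 0"
  proof (rule ccontr)
    assume neg: "\<not> ?thesis"
    have "dot v' (mv z u) = 0" for z
      by (rule H_induct[of "\<lambda>z. dot v' (mv z u) = 0"]) (use neg in \<open>auto simp: dot_mv_add\<close>)
    from this[of "outer v u'"] show False using assms(3,4) by (simp add: dot_mv_outer)
  qed
  then obtain g x where x: "g \<in> carrier G" "x \<in> H g" "dot v' (mv x u) \<noteq> 0" by blast
  let ?c = "dot v' (mv x u)"
  have "?f x \<in> H g"
    using H_mult[of "\<one> \<otimes> g" \<one>] H_mult[of \<one> g] assms(1,2) x by simp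
  then have "scal (inverse ?c) * (scal ?c * outer v u') \<in> H g"
    using H_scal x(1) by (simp add: f)
  then have "outer v u' \<in> H g"
    using x(3) by (simp add: mult.assoc[symmetric] scal_mult[symmetric])
  then show ?thesis using x(1) by blast
qed

text \<open>It suffices to find an element of \<open>H \<one>\<close> with a simple eigenvalue. A traceless \<open>x\<close> has one unless it
  is nilpotent; then \<open>x * y\<close> with \<open>tr (x * y) \<noteq> 0\<close> has one, being singular: either \<open>0\<close> or
  \<open>tr (x * y)\<close> is a simple eigenvalue.\<close>

lemma exists_rank_one_projection:
  assumes "x \<in> H \<one>" "x \<noteq> 0" "tr x = 0"
  obtains v u where "outer v u \<in> H \<one>" "dot u v = 1"
proof -
  have ex: "\<exists>z c. z \<in> H \<one> \<and> det3 (z - scal c) = 0 \<and> minor_sum (z - scal c) \<noteq> 0"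
  proof (cases "det3 x = 0")
    case False
    obtain t where t: "t^3 + minor_sum x * t + (- det3 x) = 0"
      using cubic_root_exists by blast
    have "t \<noteq> 0" using t False by auto
    show ?thesis
    proof (cases "minor_sum x + 3 * t^2 = 0")
      case False
      then show ?thesis using assms t
        by (intro exI[of _ x] exI[of _ t]) (simp add: det3_diff_scal minor_sum_diff_scal algebra_simps)
    next
      case True
      then have s: "minor_sum x = - 3 * t^2" by (simp add: eq_neg_iff_add_eq_0)
      have "det3 x = t^3 + minor_sum x * t"
        using t by simp
      then have d: "det3 x = - 2 * t^3"
        by (simp add: s algebra_simps power2_eq_square power3_eq_cube)
      \<comment> \<open>Here \<open>t\<close> is a double eigenvalue, so by trace zero the remaining
        one is \<open>- 2 * t\<close>; it is simple because it differs from \<open>t\<close> by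
        \<open>3 * t\<close>.\<close>
      have "minor_sum (x - scal (- 2 * t)) = 3 * 3 * t^2"
        using assms by (simp add: minor_sum_diff_scal s power2_eq_square)
      moreover have "det3 (x - scal (- 2 * t)) = 0"
        using assms by (simp add: det3_diff_scal s d power2_eq_square power3_eq_cube)
      moreover have "3 * 3 * t^2 \<noteq> 0"
        using three_nz \<open>t \<noteq> 0\<close> by (metis mult_eq_0_iff power_eq_0_iff)
      ultimately show ?thesis using assms(1) by metis
    qed
  next
    case True
    show ?thesis
    proof (cases "minor_sum x = 0")
      case False
      then show ?thesis using True assms by (intro exI[of _ x] exI[of _ 0]) simp
    next
      case minor_sum: True
      obtain h y where y: "h \<in> carrier G" "y \<in> H h" "tr (x * y) \<noteq> 0" "\<one> \<otimes> h = \<one>"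
        using H_dual[OF one_closed assms(1,2)] by metis
      let ?z = "x * y" 
      have z: "?z \<in> H \<one>" using y assms H_one_mult by simp
      have d: "det3 ?z = 0" using True by (simp add: det3_mult)
      show ?thesis
      proof (cases "minor_sum ?z = 0")
        case False
        then show ?thesis using z d by (intro exI[of _ ?z] exI[of _ 0]) simp
      next
        case True
        have "det3 (?z - scal (tr ?z)) = 0"
          by (simp add: det3_diff_scal True d power2_eq_square power3_eq_cube)
        moreover have "minor_sum (?z - scal (tr ?z)) = (tr ?z)^2"
          by (simp add: minor_sum_diff_scal True power2_eq_square algebra_simps)
        ultimately show ?thesis
          using z y(3) by (intro exI[of _ ?z] exI[of _ "tr ?z"]) simp
      qed
    qed
  qed
  then obtain z c where z: "z \<in> H \<one>" "det3 (z - scal c) = 0" "minor_sum (z - scal c) \<noteq> 0" by blast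
  let ?m = "z - scal c"
  obtain v u where vu: "adj ?m = scal (minor_sum ?m) * outer v u" "dot u v = 1"
    using simple_eigenvalue_projection[OF z(2,3)] by blast
  have m: "?m \<in> H \<one>" using z(1) H_diff scal_in_H by simp
  then have "adj ?m \<in> H \<one>"
    unfolding adj_eq[of ?m]
    by (intro H_add[of \<one>] H_diff[of \<one> _ "scal _ * _"] H_scal H_one_mult scal_in_H one_closed)
  then have "scal (inverse (minor_sum ?m)) * (scal (minor_sum ?m) * outer v u) \<in> H \<one>"
    using H_scal[OF one_closed] vu(1) by metis
  then have "outer v u \<in> H \<one>"
    using z(3) by (simp add: mult.assoc[symmetric] scal_mult[symmetric])
  then show thesis using that vu(2) by blast
qed

text \<open>For the given idempotent \<open>E\<close> and its complement \<open>F\<close>, a nonzero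
  homogeneous element of the form \<open>F x E\<close> is paired with a dual \<open>y\<close>. The
  product is a rank-one element of degree \<open>\<one>\<close> with nonzero trace, so it can be
  scaled to an idempotent.\<close>

lemma exists_orthogonal_projection:
  assumes "outer v1 w1 \<in> H \<one>" "dot w1 v1 = 1"
  obtains v2 w2 where "outer v2 w2 \<in> H \<one>" "dot w2 v2 = 1" "dot w1 v2 = 0" "dot w2 v1 = 0"
proof -
  let ?E = "outer v1 w1" let ?F = "1 - ?E"
  have FF: "?F * ?F = ?F" using assms(2) by (simp add: algebra_simps outer_mult_outer)
  have F: "?F \<in> H \<one>" using assms(1) one_in_H H_diff by simp
  have "\<exists>g x. g \<in> carrier G \<and> x \<in> H g \<and> ?F * x * ?E \<noteq> 0"
  proof (rule ccontr)
    assume neg: "\<not> ?thesis"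
    have all: "?F * z * ?E = 0" for z
      by (rule H_induct[of "\<lambda>z. ?F * z * ?E = 0"])
         (use neg in blast, simp only: distrib_left distrib_right add_0_left)
    \<comment> \<open>Every rank-one matrix factors through \<open>?E\<close>, so \<open>?F\<close>
      would annihilate all of them and hence the identity.\<close>
    have "?F * outer u u' = 0" for u u'
    proof -
      have "?F * outer u u' = ?F * outer u w1 * ?E * outer v1 u'"
        using assms(2) by (simp add: mult.assoc outer_mult_outer)
      then show ?thesis by (simp only: all mult_zero_left)
    qed
    then have "?F * (outer unit1 unit1 + outer unit2 unit2 + outer unit3 unit3) = 0"
      by (simp only: distrib_left add_0_left)
    then have "1 = ?E" by (simp add: sum_outer_eq_one)
    then show False using one_neq_outer by blast
  qed
  then obtain g x where x: "g \<in> carrier G" "x \<in> H g" "?F * x * ?E \<noteq> 0" by blast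
  let ?x = "?F * x * ?E"
  have xg: "?x \<in> H g"
    using H_mult[of "\<one> \<otimes> g" \<one>] H_mult[of \<one> g] assms(1) F x by simp
  obtain h y where y: "h \<in> carrier G" "y \<in> H h" "tr (?x * y) \<noteq> 0" "g \<otimes> h = \<one>"
    using H_dual[OF x(1) xg x(3)] by metis
  \<comment> \<open>The extra factor \<open>?F\<close> gives orthogonality to \<open>?E\<close> from
    the right. It leaves the trace unchanged, since moved cyclically to the front it is absorbed by
    \<open>?x\<close>.\<close>
  let ?z = "?x * y * ?F" let ?t = "tr (?x * y)"
  let ?v = "mv ?F (mv x v1)" let ?w = "vm (vm w1 y) ?F"
  have z: "?z = outer ?v ?w"
    by (simp only: mult_outer outer_mult mult.assoc mv_mult vm_mult)
  have "tr ?z = tr (?F * (?x * y))" by (rule tr_mult_commute)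
  also have "?F * (?x * y) = ?x * y" by (simp only: FF mult.assoc[symmetric])
  finally have trz: "dot ?w ?v = ?t" by (simp only: z tr_outer)
  have zH: "?z \<in> H \<one>"
    using H_mult[of "g \<otimes> h" \<one> "?x * y" ?F] H_mult[of g h ?x y] xg x(1) y F by simp
  let ?w' = "vm ?w (scal (inverse ?t))"
  show thesis
  proof (rule that[of ?v ?w'])
    show "outer ?v ?w' \<in> H \<one>"
      using zH z H_scal[OF one_closed] by (simp only: scal_mult_outer[symmetric])
    show "dot ?w' ?v = 1" using trz y(3) by simp
    show "dot w1 ?v = 0" using assms(2) by (simp add: dot_mv_one_minus_outer)
    have "dot ?w v1 = 0" using assms(2) by (simp add: dot_mv_one_minus_outer dot_vm[of _ ?F])
    then show "dot ?w' v1 = 0" by simp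
  qed
qed

lemma diagonal_case:
  assumes "x \<in> H \<one>" "x \<noteq> 0" "tr x = 0"
  obtains P Q where "P * Q = 1" "Q * P = 1"
    "\<And>i. i \<in> {unit1, unit2, unit3} \<Longrightarrow> P * outer i i * Q \<in> H \<one>"
    "\<And>i j. \<lbrakk>i \<in> {unit1, unit2, unit3}; j \<in> {unit1, unit2, unit3}\<rbrakk> \<Longrightarrow> \<exists>g\<in>carrier G. P * outer i j * Q \<in> H g"
proof -
  obtain v1 w1 where 1: "outer v1 w1 \<in> H \<one>" "dot w1 v1 = 1"
    using exists_rank_one_projection[OF assms] by blast
  obtain v2 w2 where 2: "outer v2 w2 \<in> H \<one>" "dot w2 v2 = 1" "dot w1 v2 = 0" "dot w2 v1 = 0"
    using exists_orthogonal_projection[OF 1] by blast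
  \<comment> \<open>Cross products complete \<open>v1, v2\<close> and \<open>w1, w2\<close> to dual
    bases; the normalization of the third pair is the Binet-Cauchy identity
    \<open>dot_cross_cross\<close>. The third idempotent then has degree \<open>\<one>\<close> as
    the complement of the first two.\<close>
  define v3 where "v3 = cross w1 w2"
  define w3 where "w3 = cross v1 v2"
  define P where "P = column_mat v1 v2 v3"
  define Q where "Q = row_mat w1 w2 w3"
  have d3: "dot w3 v3 = 1"
    using 1 2 by (simp add: v3_def w3_def dot_cross_cross dot_commute[of v1] dot_commute[of v2])
  have QP: "Q * P = 1"
    unfolding P_def Q_def row_mat_mult_column_mat one_mat3_def using 1 2 d3 by (simp add: v3_def w3_def)
  then have PQ: "P * Q = 1" by (rule mat3_left_inverse_imp_right_inverse)
  then have "outer v3 w3 = 1 - outer v1 w1 - outer v2 w2"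
    by (simp add: P_def Q_def column_mat_mult_row_mat algebra_simps)
  then have 3: "outer v3 w3 \<in> H \<one>"
    using 1 2 H_diff one_in_H by simp
  have PQ_outer: "M * outer i j * N = outer (mv M i) (vm j N)" for i j and M N :: "'k mat3"
    by (simp add: mult_outer outer_mult)
  show thesis
  proof (rule that[OF PQ QP])
    fix i j :: "'k \<times> 'k \<times> 'k"
    assume i: "i \<in> {unit1, unit2, unit3}"
    then show ii: "P * outer i i * Q \<in> H \<one>"
      using 1 2 3 by (auto simp: PQ_outer P_def Q_def)
    assume j: "j \<in> {unit1, unit2, unit3}"
    have "\<exists>g\<in>carrier G. outer (mv P i) (vm j Q) \<in> H g"
      by (rule unit_homogeneous[of _ "vm i Q" "mv P j"])
         (use i j 1 2 3 d3 in \<open>auto simp: P_def Q_def\<close>)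
    then show "\<exists>g\<in>carrier G. P * outer i j * Q \<in> H g"
      by (simp add: PQ_outer)
  qed
qed


text \<open>Commutation is additive in each argument, so commuting homogeneous elements would make
  the whole matrix algebra commutative.\<close>

lemma exists_noncommuting_homogeneous:
  obtains g h x y where "g \<in> carrier G" "h \<in> carrier G" "x \<in> H g" "y \<in> H h" "x * y \<noteq> y * x"
proof -
  have "\<exists>g h x y. g \<in> carrier G \<and> h \<in> carrier G \<and> x \<in> H g \<and> y \<in> H h \<and> x * y \<noteq> y * x"
  proof (rule ccontr)
    assume neg: "\<not> ?thesis"
    have 1: "x * z = z * x" if "g \<in> carrier G" "x \<in> H g" for g x z
      by (rule H_induct[of "\<lambda>z. x * z = z * x"]) (use neg that in \<open>auto simp: algebra_simps\<close>)
    have "z * y = y * z" for y z :: "'k mat3"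
      by (rule H_induct[of "\<lambda>z. z * y = y * z"]) (use 1 in \<open>auto simp: algebra_simps\<close>)
    from this[of "outer unit1 unit2" "outer unit2 unit1"] show False
      by (simp add: unit1_def unit2_def)
  qed
  then show thesis using that by blast
qed

lemma det3_scal: "det3 (scal c) = c^3"
  by (simp add: scal_def power3_eq_cube)

lemma mult_left_cancel_det3:
  fixes x y z :: "'k mat3"
  assumes "det3 x \<noteq> 0" "x * y = x * z"
  shows "y = z"
proof -
  have "scal (det3 x) * y = scal (det3 x) * z"
    by (simp only: adj_mult[symmetric] mult.assoc assms(2))
  then show ?thesis by (rule scal_left_cancel[OF assms(1)])
qed

end

section \<open>Only scalars in degree one: the matrix algebra as a graded division algebra\<close>

locale graded_mat3_scalar = graded_mat3 w G H
  for w :: "'k::alg_closed_field" and G (structure) and H :: "'g \<Rightarrow> 'k mat3 set" +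
  assumes H_one_scal: "x \<in> H \<one> \<Longrightarrow> \<exists>c. x = scal c"
begin

lemma H_inverse:
  assumes "g \<in> carrier G" "x \<in> H g" "x \<noteq> 0"
  obtains h y c where "h \<in> carrier G" "y \<in> H h" "g \<otimes> h = \<one>" "h \<otimes> g = \<one>" "c \<noteq> 0"
    "x * y = scal c" "det3 x \<noteq> 0" "det3 y \<noteq> 0"
proof -
  obtain h y where y: "h \<in> carrier G" "y \<in> H h" "tr (x * y) \<noteq> 0" "g \<otimes> h = \<one>" "h \<otimes> g = \<one>"
    using H_dual[OF assms] by blast
  have "x * y \<in> H \<one>" using H_mult[of g h x y] y assms by simp
  then obtain c where c: "x * y = scal c" using H_one_scal by blast
  then have "c \<noteq> 0" using y(3) by auto
  moreover have "det3 x * det3 y = c^3"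
    using c det3_scal by (metis det3_mult)
  moreover from calculation have "det3 x \<noteq> 0" "det3 y \<noteq> 0" by auto
  ultimately show thesis using that y c by blast
qed

text \<open>If \<open>g \<otimes> g\<close> were \<open>\<one>\<close>, then \<open>x * x\<close>
  would be a scalar and \<open>x * x * x\<close> traceless, whereas Cayley-Hamilton gives it the
  trace \<open>3 * det3 x\<close>. To obtain \<open>minor_sum x = 0\<close> also in characteristic
  2, Cayley-Hamilton is multiplied by an inverse \<open>y\<close> of \<open>x\<close> up to a scalar
  before taking traces.\<close>

lemma homogeneous_cube:
  assumes "g \<in> carrier G" "g \<noteq> \<one>" "x \<in> H g" "x \<noteq> 0"
  shows "minor_sum x = 0" "x * x * x = scal (det3 x)" "det3 x \<noteq> 0"
proof -
  obtain h y c where y: "h \<in> carrier G" "y \<in> H h" "g \<otimes> h = \<one>" "h \<otimes> g = \<one>" "c \<noteq> 0"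
    "x * y = scal c" "det3 x \<noteq> 0" "det3 y \<noteq> 0"
    using H_inverse[OF assms(1,3,4)] by blast
  show "det3 x \<noteq> 0" by fact
  have trx: "tr x = 0" using H_tr assms by blast
  have xx: "x * x \<in> H (g \<otimes> g)" using H_mult assms by blast
  have gg: "g \<otimes> g \<noteq> \<one>"
  proof
    assume "g \<otimes> g = \<one>"
    then obtain m where m: "x * x = scal m" using xx H_one_scal by auto
    have "tr (x * x * x) = 0" by (simp add: m trx)
    then have "3 * det3 x = 0" using cayley_hamilton[of x] trx by simp
    then show False using three_nz y by simp
  qed
  have "x * x * x * y \<in> H (g \<otimes> g)"
    using H_mult[of "g \<otimes> g" \<one> "x * x" "x * y"] H_mult[of g h x y] xx assms y
    by (simp add: mult.assoc)
  then have 1: "tr (x * x * x * y) = 0" using H_tr gg assms by blast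
  have "h \<noteq> \<one>" using y assms by auto
  then have 2: "tr y = 0" using H_tr y by blast
  have "tr (x * x * x * y) = - minor_sum x * tr (x * y) + det3 x * tr y"
    unfolding cayley_hamilton by (simp add: trx algebra_simps)
  then have "minor_sum x * tr (x * y) = 0" using 1 2 by simp
  then show s: "minor_sum x = 0" using y three_nz by simp
  show "x * x * x = scal (det3 x)" using cayley_hamilton[of x] by (simp add: s trx)
qed

text \<open>If \<open>z\<close> inverts \<open>x\<close> up to a scalar, then \<open>z * y\<close>
  has degree \<open>\<one>\<close> and is a scalar. Components are thus at most
  one-dimensional.\<close>

lemma homogeneous_proportional:
  assumes "g \<in> carrier G" "x \<in> H g" "x \<noteq> 0" "y \<in> H g"
  obtains q where "y = scal q * x"
proof -
  obtain h z c where z: "h \<in> carrier G" "z \<in> H h" "g \<otimes> h = \<one>" "h \<otimes> g = \<one>" "c \<noteq> 0"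
    "x * z = scal c" "det3 x \<noteq> 0" "det3 z \<noteq> 0"
    using H_inverse[OF assms(1,2,3)] by blast
  have "x * (z * x) = x * scal c"
    by (simp add: scal_commute z mult.assoc[symmetric])
  then have zx: "z * x = scal c" using mult_left_cancel_det3 z by blast
  have "z * y \<in> H \<one>" using H_mult[of h g z y] assms z by simp
  then obtain d where d: "z * y = scal d" using H_one_scal by blast
  have "z * y = z * (scal (d / c) * x)"
    using z(5) by (simp add: scal_left_commute zx d scal_mult[symmetric])
  then show thesis using mult_left_cancel_det3 z that by blast
qed

text \<open>For noncommuting homogeneous \<open>x\<close> and \<open>y\<close> the products
  \<open>x * y\<close> and \<open>y * x\<close> lie in the same one-dimensional component, so they
  differ by a factor \<open>q\<close>. As \<open>x * x * x\<close> is a scalar, moving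
  \<open>y\<close> past it gives \<open>q ^ 3 = 1\<close>.\<close>

lemma exists_weyl_pair:
  obtains g h x y where "g \<in> carrier G" "h \<in> carrier G" "x \<in> H g" "y \<in> H h"
    "x * y = scal w * (y * x)" "x * x * x = 1" "y * y * y = 1" "tr x = 0" "minor_sum x = 0"
proof -
  obtain g h x y where xy: "g \<in> carrier G" "h \<in> carrier G" "x \<in> H g" "y \<in> H h" "x * y \<noteq> y * x"
    using exists_noncommuting_homogeneous by blast
  have "g \<noteq> \<one>" using H_one_scal[of x] xy scal_commute by metis
  have "h \<noteq> \<one>" using H_one_scal[of y] xy scal_commute by metis
  have "x \<noteq> 0" "y \<noteq> 0" using xy by auto
  note x3 = homogeneous_cube[OF xy(1) \<open>g \<noteq> \<one>\<close> xy(3) \<open>x \<noteq> 0\<close>]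
  note y3 = homogeneous_cube[OF xy(2) \<open>h \<noteq> \<one>\<close> xy(4) \<open>y \<noteq> 0\<close>]
  have "g \<otimes> h = h \<otimes> g" using H_comm xy \<open>x \<noteq> 0\<close> \<open>y \<noteq> 0\<close> by blast
  then have yx: "y * x \<in> H (g \<otimes> h)" using H_mult[of h g y x] xy by simp
  have xy': "x * y \<in> H (g \<otimes> h)" using H_mult xy by blast
  have "x * y \<noteq> x * 0" using mult_left_cancel_det3 x3 \<open>y \<noteq> 0\<close> by blast
  then obtain q where q: "y * x = scal q * (x * y)"
    using homogeneous_proportional[OF _ xy' _ yx] xy by auto
  have "q \<noteq> 1" using q xy by auto
  have q': "y * (x * z) = scal q * (x * (y * z))" for z
    by (simp only: mult.assoc[symmetric] q)
  have "y * (x * x * x) = scal (q * q * q) * (x * x * x * y)"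
    by (simp only: mult.assoc q q' scal_left_commute[of x] scal_mult)
  then have "scal (det3 x) * y = scal (det3 x) * (scal (q * q * q) * y)"
    unfolding x3(2) by (simp only: scal_commute[of y] scal_left_commute[of "scal (det3 x)"])
  then have "y = scal (q * q * q) * y" using scal_left_cancel x3 by blast
  then have "y * 1 = y * scal (q * q * q)" by (simp add: scal_commute)
  then have "scal (q * q * q) = (1 :: 'k mat3)" using mult_left_cancel_det3 y3 by metis
  then have "q * q * q = 1" by (metis scal_1 scal_eq_iff)
  then have "(q - 1) * ((q - w) * (q - w * w)) = 0"
    by (simp add: algebra_simps w_square w_square')
  \<comment> \<open>In the first case \<open>x\<close> and \<open>y\<close> exchange roles; in the
    second they already satisfy the relation.\<close>
  then consider "q = w" | "q = w * w" using \<open>q \<noteq> 1\<close> by auto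
  then have "\<exists>g h x y. g \<in> carrier G \<and> h \<in> carrier G \<and> x \<in> H g \<and> y \<in> H h \<and>
    g \<noteq> \<one> \<and> h \<noteq> \<one> \<and> x \<noteq> 0 \<and> y \<noteq> 0 \<and>
    x * y = scal w * (y * x)"
  proof cases
    case 1
    then show ?thesis using xy q \<open>g \<noteq> \<one>\<close> \<open>h \<noteq> \<one>\<close> \<open>x \<noteq> 0\<close> \<open>y \<noteq> 0\<close> by metis
  next
    case 2
    have "scal w * (y * x) = scal (w * (w * w)) * (x * y)"
      unfolding q 2 by (simp only: scal_mult mult.assoc)
    then have "x * y = scal w * (y * x)" by (simp add: w_cube)
    then show ?thesis using xy \<open>g \<noteq> \<one>\<close> \<open>h \<noteq> \<one>\<close> \<open>x \<noteq> 0\<close> \<open>y \<noteq> 0\<close> by metis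
  qed
  then obtain g h x y where xy: "g \<in> carrier G" "h \<in> carrier G" "x \<in> H g" "y \<in> H h"
    "g \<noteq> \<one>" "h \<noteq> \<one>" "x \<noteq> 0" "y \<noteq> 0" "x * y = scal w * (y * x)" by blast
  note x3 = homogeneous_cube[OF xy(1,5,3,7)]
  note y3 = homogeneous_cube[OF xy(2,6,4,8)]
  \<comment> \<open>By \<open>homogeneous_cube\<close> the cube of \<open>x\<close> is the scalar
    \<open>det3 x\<close>, so scaling by \<open>a\<close> makes it 1.\<close>
  obtain a where a: "a^3 = inverse (det3 x)" using nth_root_exists[of 3 "inverse (det3 x)"] by auto
  obtain b where b: "b^3 = inverse (det3 y)" using nth_root_exists[of 3 "inverse (det3 y)"] by auto
  have sc: "scal c * z * (scal c * z) * (scal c * z) = scal (c^3) * (z * z * z)" for c and z :: "'k mat3"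
    by (simp only: mult.assoc scal_left_commute[of z] scal_mult power3_eq_cube)
  show thesis
  proof (rule that[of g h "scal a * x" "scal b * y"])
    show "scal a * x \<in> H g" "scal b * y \<in> H h" using xy H_scal by blast+
    show "scal a * x * (scal b * y) = scal w * (scal b * y * (scal a * x))"
      by (simp only: mult.assoc scal_left_commute[of x] scal_left_commute[of y] xy(9))
         (simp only: mult.assoc[symmetric] scal_mult[symmetric], simp only: ac_simps)
    show "scal a * x * (scal a * x) * (scal a * x) = 1" "scal b * y * (scal b * y) * (scal b * y) = 1"
      using x3 y3 a b by (simp_all add: sc scal_mult[symmetric])
    show "tr (scal a * x) = 0" using H_tr xy by simp
    have "minor_sum (scal a * x) = a^2 * minor_sum x"
      by (cases x) (simp add: scal_def power2_eq_square algebra_simps)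
    then show "minor_sum (scal a * x) = 0" using x3 by simp
  qed (use xy in auto)
qed

text \<open>The characteristic polynomial of \<open>x\<close> is \<open>t^3 - 1\<close>, whose
  derivative at 1 is 3, so 1 is a simple eigenvalue. For its eigenvector \<open>v\<close>, the
  vectors \<open>v\<close>, \<open>y v\<close>, \<open>y^2 v\<close> form a basis in which
  \<open>x\<close> is the clock and \<open>y\<close> the shift.\<close>

lemma pauli_case:
  obtains P Q g h where "P * Q = 1" "Q * P = 1" "g \<in> carrier G" "h \<in> carrier G"
    "P * clock w * Q \<in> H g" "P * shift * Q \<in> H h"
proof -
  obtain g h x y where xy: "g \<in> carrier G" "h \<in> carrier G" "x \<in> H g" "y \<in> H h"
    "x * y = scal w * (y * x)" "x * x * x = 1" "y * y * y = 1" "tr x = 0" "minor_sum x = 0"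
    using exists_weyl_pair by blast
  have d: "det3 x = 1"
    using cayley_hamilton[of x] xy by (simp, metis scal_1 scal_eq_iff)
  let ?m = "x - scal 1"
  have "det3 ?m = 0" "minor_sum ?m = 3"
    unfolding det3_diff_scal minor_sum_diff_scal using xy d by simp_all
  then obtain v u where vu: "adj ?m = scal 3 * outer v u" "dot u v = 1"
    using simple_eigenvalue_projection[of ?m] three_nz by metis
  let ?p = "outer v u"
  have "scal 3 * (x * ?p) = scal 3 * ?p" "scal 3 * (?p * x) = scal 3 * ?p"
    using mult_adj[of ?m] adj_mult[of ?m] \<open>det3 ?m = 0\<close> unfolding vu(1)
    by (simp_all add: algebra_simps scal_left_commute mult.assoc)
  then have xp: "x * ?p = ?p" "?p * x = ?p"
    using scal_left_cancel[OF three_nz] by blast+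
  have "mv (x * ?p) v = mv ?p v" by (simp only: xp)
  then have xv: "mv x v = v" using vu(2) by (simp add: mv_mult mv_outer)
  \<comment> \<open>The projection \<open>?p\<close> absorbs \<open>x\<close> on either side, so
    moving \<open>x\<close> across \<open>z\<close> multiplies \<open>?p * z * ?p\<close> by
    \<open>c \<noteq> 1\<close>; hence its trace is zero.\<close>
  have dot0: "dot u (mv z v) = 0" if z: "x * z = scal c * (z * x)" "c \<noteq> 1" for z c
  proof -
    have "?p * z * ?p = ?p * (x * z) * ?p" by (simp only: xp mult.assoc[symmetric])
    also have "\<dots> = scal c * (?p * z * (x * ?p))"
      unfolding z(1) by (simp only: mult.assoc scal_left_commute)
    finally have "?p * z * ?p = scal c * (?p * z * ?p)" by (simp only: xp)
    then have "tr (?p * z * ?p) = c * tr (?p * z * ?p)" by (metis tr_scal_mult)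
    moreover have "tr (?p * z * ?p) = dot u (mv z v)"
      by (simp only: outer_mult[of v u z] outer_mult_outer tr_scal_mult tr_outer dot_vm vu(2) mult_1_right)
    ultimately have "dot u (mv z v) = c * dot u (mv z v)" by simp
    then show ?thesis using z(2) by (simp add: algebra_simps)
  qed
  have xyy: "x * (y * y) = scal (w * w) * (y * y * x)"
    by (metis (no_types, lifting) mult.assoc scal_left_commute scal_mult xy(5))
  have w2: "w * w \<noteq> 1" using w_cube w_neq_one by auto
  have uy: "dot u (mv y v) = 0" "dot u (mv (y * y) v) = 0"
    using dot0[OF xy(5) w_neq_one] dot0[OF xyy w2] by auto
  define P where "P = column_mat v (mv y v) (mv (y * y) v)"
  \<comment> \<open>As \<open>y * y\<close> is the inverse of \<open>y\<close>, these rows are dual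
    to the columns of \<open>P\<close>, which explains their order.\<close>
  define Q where "Q = row_mat u (vm u (y * y)) (vm u y)"
  have QP: "Q * P = 1"
    unfolding P_def Q_def row_mat_mult_column_mat one_mat3_def
    using uy vu(2) xy(7) by (simp add: dot_vm mv_mult[symmetric] mult.assoc[symmetric])
  then have PQ: "P * Q = 1" by (rule mat3_left_inverse_imp_right_inverse)
  have xP: "x * P = P * clock w"
    unfolding P_def mult_column_mat column_mat_mult_clock by (simp only: mv_mult[symmetric] xy(5) xyy) (simp only: mv_mult xv)
  have yP: "y * P = P * shift"
    unfolding P_def mult_column_mat column_mat_mult_shift using xy(7) by (simp add: mv_mult[symmetric] mult.assoc[symmetric])
  have "x = P * clock w * Q" "y = P * shift * Q"
    unfolding xP[symmetric] yP[symmetric] by (simp_all add: mult.assoc PQ)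
  then show thesis using that PQ QP xy by metis
qed

end

section \<open>From the pseudo-octonion algebra to the matrix algebra\<close>

context cube_root
begin

section \<open>The symmetric composition identity and recovery of the matrix product\<close>

lemma okubo_prod_alt:
  "okubo_prod w x y = scal w * (x * y) + (1 + scal w) * (y * x) - scal (r * tr (x * y))"
  unfolding okubo_prod_eq by (simp add: scal_diff scal_minus algebra_simps)

lemma okubo_prod_tr: "tr (okubo_prod w x y) = 0"
proof -
  have "tr (okubo_prod w x y) = w * tr (x * y) - (- 1 - w) * tr (x * y) - 3 * r * tr (x * y)"
    unfolding okubo_prod_eq by (simp only: tr_diff tr_scal_mult tr_scal tr_mult_commute[of y x] mult.assoc)
  then show ?thesis unfolding three_r by (simp add: algebra_simps)
qed

lemma scal_w_square: "scal w * scal w = - 1 - scal w"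
  by (simp only: scal_mult[symmetric] w_square scal_diff scal_minus scal_1)

lemma r_w: "r * (2 * w + 1) = - 1"
  using s_nz by (simp add: r_eq s_def)

text \<open>The triple products carry the coefficients \<open>w^4 = w\<close>,
  \<open>w^2 = - (1 + w)\<close> and \<open>- w^3 = - 1\<close>. Adding the expression with
  \<open>a\<close> and \<open>b\<close> exchanged makes every coefficient \<open>- 1\<close>, since
  \<open>w + w^2 = - 1\<close>. The last scalar stays unexpanded because a comparison of traces
  disposes of it afterwards.\<close>

lemma okubo_prod_okubo_prod:
  "okubo_prod w (okubo_prod w a c) b = scal w * (b * c * a) - (1 + scal w) * (a * c * b) - c * a * b
     - b * a * c + scal (tr (a * c)) * b - scal (r * tr (okubo_prod w a c * b))"
proof -
  let ?k = "r * tr (a * c)" and ?W = "scal w"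
  let ?m = "?W * (a * c) + (1 + ?W) * (c * a)"
  have W: "?W * (?W * x) = - x - ?W * x" for x
    by (simp only: mult.assoc[symmetric] scal_w_square) (simp add: algebra_simps)
  have 1: "okubo_prod w a c = ?m - scal ?k" by (rule okubo_prod_alt)
  have 2: "?W * (?m * b) + (1 + ?W) * (b * ?m)
      = ?W * (b * c * a) - (1 + ?W) * (a * c * b) - c * a * b - b * a * c"
    by (simp add: algebra_simps scal_left_commute[of b] W)
  have "?W * (scal ?k * b) + (1 + ?W) * (b * scal ?k) = scal (?k * (2 * w + 1)) * b"
    by (simp only: scal_commute[of b] mult.assoc[symmetric] scal_1[symmetric] scal_add[symmetric]
        scal_mult[symmetric] distrib_right[symmetric]) (simp add: algebra_simps)
  also have "?k * (2 * w + 1) = - tr (a * c)"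
    using r_w by (metis mult.assoc mult.commute mult_minus1)
  finally have 3: "?W * (scal ?k * b) + (1 + ?W) * (b * scal ?k) = - scal (tr (a * c)) * b"
    by (simp add: scal_minus)
  have "okubo_prod w (okubo_prod w a c) b = ?W * ((?m - scal ?k) * b) + (1 + ?W) * (b * (?m - scal ?k))
      - scal (r * tr (okubo_prod w a c * b))"
    by (simp only: okubo_prod_alt[of "okubo_prod w a c"] 1[symmetric])
  also have "?W * ((?m - scal ?k) * b) + (1 + ?W) * (b * (?m - scal ?k)) =
      (?W * (?m * b) + (1 + ?W) * (b * ?m)) - (?W * (scal ?k * b) + (1 + ?W) * (b * scal ?k))"
    by (simp only: left_diff_distrib right_diff_distrib) simp
  finally show ?thesis unfolding 2 3 by simp
qed

text \<open>Up to scalars the left hand side is the negated full polarization of the cube, so this is the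
  polarized Cayley-Hamilton identity.\<close>

lemma okubo_prod_symmetric_composition:
  assumes "tr a = 0" "tr b = 0" "tr c = 0"
  shows "okubo_prod w (okubo_prod w a c) b + okubo_prod w (okubo_prod w b c) a = - (scal (tr (a * b)) * c)"
    (is "?l = _")
proof -
  let ?u = "r * tr (okubo_prod w a c * b) + r * tr (okubo_prod w b c * a)"
  let ?k = "- (tr (a*b*c) + tr (a*c*b)) - ?u"
  have "?l = - (a*b*c + a*c*b + b*a*c + b*c*a + c*a*b + c*b*a)
      + scal (tr (a * c)) * b + scal (tr (b * c)) * a - scal ?u"
    unfolding okubo_prod_okubo_prod by (simp add: algebra_simps scal_add)
  also have "\<dots> = - (scal (tr (a * b)) * c) + scal ?k"
    unfolding polarized_cayley_hamilton[OF assms] by (simp add: algebra_simps scal_add scal_diff scal_minus)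
  finally have l: "?l = - (scal (tr (a * b)) * c) + scal ?k" .
  have "tr ?l = 0" by (simp only: tr_add okubo_prod_tr add_0_left)
  then have "3 * ?k = 0" unfolding l by (simp only: tr_add tr_minus tr_scal_mult tr_scal assms(3)) simp
  then have "?k = 0" using three_nz by (metis mult_eq_0_iff)
  then show ?thesis using l by simp
qed

text \<open>The weight \<open>w\<close> on the second product cancels the terms in
  \<open>y * x\<close>, as \<open>- w^2 + w * w = 0\<close>.\<close>

lemma mult_eq_okubo_prod:
  "scal (w - 1) * (x * y) =
     okubo_prod w x y + scal w * okubo_prod w y x + scal ((1 + w) * r * tr (x * y))"
proof -
  have "okubo_prod w x y + scal w * okubo_prod w y x = (scal w + scal w + scal w * scal w) * (x * y)
      + (1 + scal w + scal w * scal w) * (y * x) - scal ((1 + w) * r * tr (x * y))"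
    unfolding okubo_prod_alt tr_mult_commute[of y x]
    by (simp add: scal_add scal_mult algebra_simps)
  then show ?thesis
    unfolding scal_w_square by (simp add: scal_diff algebra_simps)
qed

end

text \<open>\<open>B_indep\<close> extracts from directness of the sum what a two-term identity with
  homogeneous right-hand side requires.\<close>

locale graded_sl3 = group G + cube_root w
  for w :: "'k::alg_closed_field" and G (structure) +
  fixes B :: "'g \<Rightarrow> 'k mat3 set"
  assumes B_zero: "g \<in> carrier G \<Longrightarrow> 0 \<in> B g"
    and B_add: "\<lbrakk>g \<in> carrier G; x \<in> B g; y \<in> B g\<rbrakk> \<Longrightarrow> x + y \<in> B g"
    and B_scal: "\<lbrakk>g \<in> carrier G; x \<in> B g\<rbrakk> \<Longrightarrow> scal c * x \<in> B g"
    and B_tr: "\<lbrakk>g \<in> carrier G; x \<in> B g\<rbrakk> \<Longrightarrow> tr x = 0"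
    and B_mult: "\<lbrakk>g \<in> carrier G; h \<in> carrier G; x \<in> B g; y \<in> B h\<rbrakk> \<Longrightarrow> okubo_prod w x y \<in> B (g \<otimes> h)"
    and B_induct: "\<lbrakk>tr z = 0; P 0; \<And>g x. g \<in> carrier G \<Longrightarrow> x \<in> B g \<Longrightarrow> P x;
      \<And>x y. P x \<Longrightarrow> P y \<Longrightarrow> P (x + y)\<rbrakk> \<Longrightarrow> P z"
    and B_indep: "\<lbrakk>f \<in> carrier G; g \<in> carrier G; h \<in> carrier G; x \<in> B g; y \<in> B h; x + y \<in> B f;
      x + y \<noteq> 0\<rbrakk> \<Longrightarrow> f = g \<or> f = h"
begin

text \<open>Since 3 is invertible, every matrix is a traceless one plus a scalar, and scalars are
  orthogonal to the traceless \<open>x\<close>; so a partner can be found among traceless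
  homogeneous elements.\<close>

lemma B_dual:
  assumes "g \<in> carrier G" "x \<in> B g" "x \<noteq> 0"
  obtains h y where "h \<in> carrier G" "y \<in> B h" "tr (x * y) \<noteq> 0"
proof -
  have "\<exists>h y. h \<in> carrier G \<and> y \<in> B h \<and> tr (x * y) \<noteq> 0"
  proof (rule ccontr)
    assume neg: "\<not> ?thesis"
    have 0: "tr (x * z) = 0" if "tr z = 0" for z
      using that by (rule B_induct[of z "\<lambda>z. tr (x * z) = 0"]) (use neg in \<open>auto simp: algebra_simps\<close>)
    have "tr (x * z) = 0" for z
    proof -
      have "x * z = x * (z - scal (tr z / 3)) + scal (tr z / 3) * x"
        by (simp add: algebra_simps scal_commute)
      moreover have "tr (x * (z - scal (tr z / 3))) = 0"
        by (rule 0) (use three_nz in simp)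
      ultimately show ?thesis using B_tr[OF assms(1,2)] by simp
    qed
    then show False using assms(3) tr_nondegenerate by blast
  qed
  then show thesis using that by blast
qed

text \<open>Both summands of \<open>(a * c) * b + (b * c) * a = - tr (a * b) c\<close> are homogeneous, and so is \<open>c\<close>.\<close>

lemma degrees_of_nonorthogonal:
  assumes "g \<in> carrier G" "h \<in> carrier G" "f \<in> carrier G" "a \<in> B g" "b \<in> B h" "c \<in> B f"
    "tr (a * b) \<noteq> 0" "c \<noteq> 0"
  shows "f = g \<otimes> f \<otimes> h \<or> f = h \<otimes> f \<otimes> g"
proof -
  let ?x = "okubo_prod w (okubo_prod w a c) b" and ?y = "okubo_prod w (okubo_prod w b c) a"
  have xy: "?x + ?y = scal (- tr (a * b)) * c"
    using okubo_prod_symmetric_composition[of a b c] B_tr assms by (simp add: scal_minus)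
  have "?x + ?y \<noteq> 0"
    unfolding xy using scal_left_cancel[of "- tr (a * b)" c 0] assms by auto
  then show ?thesis
    using B_indep[of f "g \<otimes> f \<otimes> h" "h \<otimes> f \<otimes> g" ?x ?y] B_mult B_scal assms xy by simp
qed

text \<open>With \<open>c = a\<close> in \<open>degrees_of_nonorthogonal\<close>, the factor
  \<open>g\<close> cancels and leaves an equation between \<open>g\<close> and
  \<open>h\<close>.\<close>

lemma nonorthogonal_imp_inverse:
  assumes "g \<in> carrier G" "h \<in> carrier G" "a \<in> B g" "b \<in> B h" "tr (a * b) \<noteq> 0"
  shows "g \<otimes> h = \<one>"
proof -
  have "a \<noteq> 0" using assms(5) by auto
  then have "g = g \<otimes> g \<otimes> h \<or> g = h \<otimes> g \<otimes> g"
    using degrees_of_nonorthogonal[OF assms(1,2,1,3,4,3,5)] by blast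
  then show ?thesis
  proof
    assume "g = g \<otimes> g \<otimes> h"
    then show ?thesis using assms by (metis m_assoc m_closed l_cancel_one)
  next
    assume "g = h \<otimes> g \<otimes> g"
    then show ?thesis using assms by (metis m_closed r_cancel_one inv_comm)
  qed
qed

text \<open>A trace partner of \<open>a\<close> has the degree inverse to \<open>g\<close>. Applied
  to this pair and \<open>c\<close>, \<open>degrees_of_nonorthogonal\<close> says that conjugation
  by \<open>g\<close> or by its inverse fixes \<open>f\<close>.\<close>

lemma support_commutes:
  assumes "g \<in> carrier G" "f \<in> carrier G" "a \<in> B g" "c \<in> B f" "a \<noteq> 0" "c \<noteq> 0"
  shows "g \<otimes> f = f \<otimes> g"
proof -
  obtain h b where b: "h \<in> carrier G" "b \<in> B h" "tr (a * b) \<noteq> 0"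
    using B_dual assms by blast
  have gh: "g \<otimes> h = \<one>" using nonorthogonal_imp_inverse assms b by blast
  then have hg: "h \<otimes> g = \<one>" using inv_comm assms b by blast
  have "f = g \<otimes> f \<otimes> h \<or> f = h \<otimes> f \<otimes> g"
    using degrees_of_nonorthogonal assms b by blast
  then show ?thesis
  proof
    assume "f = g \<otimes> f \<otimes> h"
    then have "f \<otimes> g = g \<otimes> f \<otimes> h \<otimes> g" by simp
    also have "\<dots> = g \<otimes> f" using assms b hg by (simp add: m_assoc)
    finally show ?thesis by simp
  next
    assume "f = h \<otimes> f \<otimes> g"
    then have "g \<otimes> f = g \<otimes> (h \<otimes> f \<otimes> g)" by simp
    also have "\<dots> = (g \<otimes> h) \<otimes> f \<otimes> g" using assms b by (simp add: m_assoc)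
    also have "\<dots> = f \<otimes> g" using assms gh by simp
    finally show ?thesis .
  qed
qed

definition H :: "'g \<Rightarrow> 'k mat3 set" where
  "H g = {x + scal c | x c. x \<in> B g \<and> (g \<noteq> \<one> \<longrightarrow> c = 0)}"

lemma B_subset_H: "x \<in> B g \<Longrightarrow> x \<in> H g"
  by (force simp: H_def intro: exI[of _ 0])

lemma scal_mem_H: "scal c \<in> H \<one>"
  unfolding H_def using B_zero[OF one_closed] by force

text \<open>The way back: traceless matrices found to be homogeneous for \<open>H\<close> belong to
  the original components.\<close>

lemma H_tr_zero:
  assumes "g \<in> carrier G" "x \<in> H g" "tr x = 0"
  shows "x \<in> B g"
proof -
  obtain y c where y: "x = y + scal c" "y \<in> B g"
    using assms(2) unfolding H_def by blast
  then have "3 * c = 0" using assms(1,3) B_tr by simp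
  then show ?thesis using y three_nz by simp
qed

lemma H_add': "\<lbrakk>g \<in> carrier G; x \<in> H g; y \<in> H g\<rbrakk> \<Longrightarrow> x + y \<in> H g"
proof -
  assume g: "g \<in> carrier G" and "x \<in> H g" "y \<in> H g"
  then obtain x' c y' d where "x = x' + scal c" "y = y' + scal d" "x' \<in> B g" "y' \<in> B g"
    "g \<noteq> \<one> \<longrightarrow> c = 0" "g \<noteq> \<one> \<longrightarrow> d = 0" unfolding H_def by blast
  then show "x + y \<in> H g" unfolding H_def using B_add[OF g]
    by (intro CollectI exI[of _ "x' + y'"] exI[of _ "c + d"]) (simp add: scal_add algebra_simps)
qed

lemma H_scal': "\<lbrakk>g \<in> carrier G; x \<in> H g\<rbrakk> \<Longrightarrow> scal c * x \<in> H g"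
proof -
  assume g: "g \<in> carrier G" and "x \<in> H g"
  then obtain x' d where "x = x' + scal d" "x' \<in> B g" "g \<noteq> \<one> \<longrightarrow> d = 0" unfolding H_def by blast
  then show "scal c * x \<in> H g" unfolding H_def using B_scal[OF g]
    by (intro CollectI exI[of _ "scal c * x'"] exI[of _ "c * d"]) (simp add: scal_mult algebra_simps)
qed

text \<open>The scalar term of \<open>mult_eq_okubo_prod\<close> is nonzero only if
  \<open>g \<otimes> h = \<one>\<close>, the one degree in which \<open>H\<close> admits
  scalars.\<close>

lemma B_mult_in_H:
  assumes "g \<in> carrier G" "h \<in> carrier G" "x \<in> B g" "y \<in> B h"
  shows "x * y \<in> H (g \<otimes> h)"
proof (cases "x = 0 \<or> y = 0")
  case True
  then show ?thesis using B_zero assms B_subset_H by auto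
next
  case False
  have comm: "g \<otimes> h = h \<otimes> g" using support_commutes assms False by blast
  have gh: "g \<otimes> h \<in> carrier G" using assms by simp
  have 1: "scal ((1 + w) * r * tr (x * y)) \<in> H (g \<otimes> h)"
  proof (cases "tr (x * y) = 0")
    case True
    then show ?thesis using B_zero[OF gh] B_subset_H by simp
  next
    case False
    then show ?thesis using nonorthogonal_imp_inverse assms scal_mem_H by metis
  qed
  have "scal (w - 1) * (x * y) \<in> H (g \<otimes> h)"
    unfolding mult_eq_okubo_prod
    by (intro H_add'[OF gh] H_scal'[OF gh] 1)
       (use B_mult assms comm B_subset_H in \<open>metis+\<close>)
  then have "scal (inverse (w - 1)) * (scal (w - 1) * (x * y)) \<in> H (g \<otimes> h)"
    using H_scal' gh by blast
  then show ?thesis using w_neq_one by (simp add: mult.assoc[symmetric] scal_mult[symmetric])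
qed

lemma H_mult':
  assumes "g \<in> carrier G" "h \<in> carrier G" "x \<in> H g" "y \<in> H h"
  shows "x * y \<in> H (g \<otimes> h)"
proof -
  obtain x' c where x: "x = x' + scal c" "x' \<in> B g" "g \<noteq> \<one> \<longrightarrow> c = 0"
    using assms(3) unfolding H_def by blast
  obtain y' d where y: "y = y' + scal d" "y' \<in> B h" "h \<noteq> \<one> \<longrightarrow> d = 0"
    using assms(4) unfolding H_def by blast
  have gh: "g \<otimes> h \<in> carrier G" using assms by simp
  have z: "0 \<in> H (g \<otimes> h)" using B_zero[OF gh] B_subset_H by blast
  have 1: "scal c * y \<in> H (g \<otimes> h)"
    using x(3) z H_scal' assms by (cases "c = 0") auto
  have 2: "scal d * x' \<in> H (g \<otimes> h)"
    using y(3) z H_scal' assms B_subset_H x(2) by (cases "d = 0") auto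
  have "x * y = x' * y' + (scal d * x' + scal c * y)"
    by (simp add: x y algebra_simps scal_commute[of x'])
  then show ?thesis
    using H_add'[OF gh] B_mult_in_H assms x y 1 2 by simp
qed

lemma graded_mat3: "graded_mat3 w G H"
proof unfold_locales
  show "1 \<in> H \<one>" using scal_mem_H[of 1] by simp
  show "tr x = 0" if "g \<in> carrier G" "g \<noteq> \<one>" "x \<in> H g" for g x
    using that B_tr by (auto simp: H_def)
  show "g \<otimes> h = h \<otimes> g" if "g \<in> carrier G" "h \<in> carrier G" "x \<in> H g" "y \<in> H h" "x \<noteq> 0" "y \<noteq> 0"
    for g h x y
  proof (cases "g = \<one> \<or> h = \<one>")
    case False
    then have "x \<in> B g" "y \<in> B h" using that by (auto simp: H_def)
    then show ?thesis using support_commutes that by blast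
  qed (use that in auto)
  show "P z" if 1: "\<And>g x. g \<in> carrier G \<Longrightarrow> x \<in> H g \<Longrightarrow> P x"
      and 2: "\<And>x y. P x \<Longrightarrow> P y \<Longrightarrow> P (x + y)"
    for P z
  proof -
    have 0: "P 0" using 1[of \<one> 0] scal_mem_H[of 0] by simp
    have "P (z - scal (tr z / 3))"
      by (rule B_induct) (use 0 1 2 three_nz B_subset_H in auto)
    moreover have "P (scal (tr z / 3))" using 1 scal_mem_H by blast
    ultimately have "P (z - scal (tr z / 3) + scal (tr z / 3))" by (rule 2)
    then show ?thesis by simp
  qed
qed (use H_add' H_scal' H_mult' in auto)

theorem diagonal_or_pauli:
  "(\<exists>P Q. P * Q = 1 \<and> Q * P = 1 \<and> (\<forall>i\<in>{unit1, unit2, unit3}. P * outer i i * Q \<in> H \<one>) \<and>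
      (\<forall>i\<in>{unit1, unit2, unit3}. \<forall>j\<in>{unit1, unit2, unit3}. \<exists>g\<in>carrier G. P * outer i j * Q \<in> H g)) \<or>
   (\<exists>P Q g h. P * Q = 1 \<and> Q * P = 1 \<and> g \<in> carrier G \<and> h \<in> carrier G \<and>
      P * clock w * Q \<in> H g \<and> P * shift * Q \<in> H h)"
proof -
  interpret M: graded_mat3 w G H by (rule graded_mat3)
  show ?thesis
  proof (cases "\<exists>x\<in>H \<one>. x \<noteq> 0 \<and> tr x = 0")
    case True
    then show ?thesis using M.diagonal_case by metis
  next
    case False
    interpret S: graded_mat3_scalar w G H
    proof unfold_locales
      fix x assume x: "x \<in> H \<one>"
      have "x - scal (tr x / 3) \<in> H \<one>" using M.H_diff x M.scal_in_H by simp
      moreover have "tr (x - scal (tr x / 3)) = 0" using three_nz by simp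
      ultimately have "x - scal (tr x / 3) = 0" using False by blast
      then show "\<exists>c. x = scal c" by auto
    qed
    show ?thesis using S.pauli_case by metis
  qed
qed

end

section \<open>The standard gradings\<close>

text \<open>Membership as a condition on coordinates reduces homogeneity of a multiplication table
  to a finite check.\<close>

lemma mem_component_of_degree: "x \<in> component_of_degree deg d \<longleftrightarrow> (\<forall>b. x $ b \<noteq> 0 \<longrightarrow> deg b = d)"
proof
  assume "x \<in> component_of_degree deg d"
  then show "\<forall>b. x $ b \<noteq> 0 \<longrightarrow> deg b = d"
    unfolding component_of_degree_def
    by (induction rule: vec.span_induct_alt) (auto simp: bas_nth split: if_splits)
next
  assume x: "\<forall>b. x $ b \<noteq> 0 \<longrightarrow> deg b = d"
  have "x = (\<Sum>b\<in>UNIV. x $ b *s bas b)"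
    by (simp add: vec_eq_iff bas_nth if_distrib[of "(*) _"] cong: if_cong)
  also have "\<dots> \<in> component_of_degree deg d"
    unfolding component_of_degree_def
  proof (rule vec.span_sum)
    fix b
    show "x $ b *s bas b \<in> vec.span {bas b |b. deg b = d}"
      using x by (cases "x $ b = 0") (auto intro: vec.span_scale vec.span_base vec.span_zero)
  qed
  finally show "x \<in> component_of_degree deg d" .
qed

lemma subspace_component_of_degree: "vec.subspace (component_of_degree deg d)"
  unfolding component_of_degree_def by (rule vec.subspace_span)

lemma is_direct_sum_component_of_degree:
  fixes deg :: "'b::finite \<Rightarrow> 'd"
  assumes "\<And>b. deg b \<in> I"
  shows "is_direct_sum I (component_of_degree deg :: 'd \<Rightarrow> ('k::field ^ 'b) set)"
  unfolding is_direct_sum_def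
proof (intro conjI ballI allI subspace_component_of_degree)
  fix x :: "'k ^ 'b"
  let ?p = "\<lambda>d. (\<chi> b. if deg b = d then x $ b else 0) :: 'k ^ 'b"
  show "\<exists>!c. (\<forall>i\<in>I. c i \<in> component_of_degree deg i) \<and> (\<forall>i. i \<notin> I \<longrightarrow> c i = 0) \<and>
      finite {i. c i \<noteq> 0} \<and> x = (\<Sum>i | c i \<noteq> 0. c i)"
  proof (rule ex1I[of _ ?p], intro conjI)
    have sub: "{i. ?p i \<noteq> 0} \<subseteq> range deg"
      by (auto simp: vec_eq_iff split: if_splits)
    then show fin: "finite {i. ?p i \<noteq> 0}" by (rule finite_subset) simp
    have "(\<Sum>i | ?p i \<noteq> 0. ?p i) = (\<Sum>i\<in>range deg. ?p i)"
      by (rule sum.mono_neutral_left) (use sub in auto)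
    then show "x = (\<Sum>i | ?p i \<noteq> 0. ?p i)"
      by (simp add: vec_eq_iff)
    show "\<forall>i\<in>I. ?p i \<in> component_of_degree deg i"
      by (auto simp: mem_component_of_degree)
    show "\<forall>i. i \<notin> I \<longrightarrow> ?p i = 0"
      using assms by (auto simp: vec_eq_iff)
  next
    fix c
    assume c: "(\<forall>i\<in>I. c i \<in> component_of_degree deg i) \<and> (\<forall>i. i \<notin> I \<longrightarrow> c i = 0) \<and>
      finite {i. c i \<noteq> 0} \<and> x = (\<Sum>i | c i \<noteq> 0. c i)"
    have d: "c i $ b = 0" if "deg b \<noteq> i" for i b
      using c that by (cases "i \<in> I") (auto simp: mem_component_of_degree)
    have x: "x $ b = c (deg b) $ b" for b
    proof -
      have "x $ b = (\<Sum>i | c i \<noteq> 0. c i $ b)" using c by (metis sum_component)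
      also have "\<dots> = (\<Sum>i | c i \<noteq> 0. if i = deg b then c i $ b else 0)"
        by (rule sum.cong) (auto intro: d)
      also have "\<dots> = c (deg b) $ b" using c by simp
      finally show ?thesis .
    qed
    show "c = ?p" using d x by (auto simp: fun_eq_iff vec_eq_iff)
  qed
qed

lemma bilinear_ext_graded:
  assumes "\<And>a b. t a b \<in> component_of_degree deg (op (deg a) (deg b))"
    and "x \<in> component_of_degree deg d" "y \<in> component_of_degree deg d'"
  shows "bilinear_ext t x y \<in> component_of_degree deg (op d d')"
  unfolding mem_component_of_degree
proof (intro allI impI, rule ccontr)
  fix c
  assume nz: "bilinear_ext t x y $ c \<noteq> 0" and deg: "deg c \<noteq> op d d'"
  have "x $ a * y $ b * t a b $ c = 0" for a b
  proof (rule ccontr)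
    assume "x $ a * y $ b * t a b $ c \<noteq> 0"
    then have "deg a = d" "deg b = d'" "t a b $ c \<noteq> 0"
      using assms by (auto simp: mem_component_of_degree)
    then show False using assms(1)[of a b] deg by (auto simp: mem_component_of_degree)
  qed
  then have "bilinear_ext t x y $ c = 0"
    unfolding bilinear_ext_nth by (intro sum.neutral ballI)
  then show False using nz by simp
qed

lemma component_of_degree_nonzero: "component_of_degree deg (deg b) \<noteq> {0 :: 'k::field ^ 'b::finite}"
proof -
  have "bas b \<in> component_of_degree deg (deg b)" by (auto simp: mem_component_of_degree bas_nth split: if_splits)
  moreover have "bas b \<noteq> (0 :: 'k ^ 'b)" by (auto simp: vec_eq_iff bas_nth)
  ultimately show ?thesis by blast
qed

section \<open>The grading by pairs of residues modulo 3\<close>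

lemma group_Z33: "group Z33_group"
  unfolding Z33_group_def by (intro DirProd_group group_integer_mod_group)

lemma carrier_Z33: "carrier Z33_group = {0, 1, 2} \<times> {0, 1, 2}"
proof -
  have "{0..<3::int} = {0, 1, 2}"
  proof (rule Set.set_eqI)
    show "x \<in> {0..<3::int} \<longleftrightarrow> x \<in> {0, 1, 2}" for x by (simp, arith)
  qed
  then show ?thesis by (simp add: Z33_group_def carrier_integer_mod_group)
qed

lemma Z33_grading_is_group_grading:
  "group_grading Z33_group (okubo_mult a b) (Z33_grading :: _ \<Rightarrow> ('k::field ^ _) set)"
  unfolding group_grading_def
proof (intro conjI ballI)
  show "group Z33_group" by (rule group_Z33)
  have deg: "okubo_degree b \<in> carrier Z33_group" for b
    by (cases b) (simp_all add: okubo_degree_def carrier_Z33)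
  then show "is_direct_sum (carrier Z33_group) (Z33_grading :: _ \<Rightarrow> ('k ^ _) set)"
    unfolding Z33_grading_def by (rule is_direct_sum_component_of_degree)
  fix g h and x y :: "'k ^ okubo_basis"
  assume "x \<in> Z33_grading g" "y \<in> Z33_grading h"
  moreover have "okubo_table a b c d
      \<in> component_of_degree okubo_degree (okubo_degree c \<otimes>\<^bsub>Z33_group\<^esub> okubo_degree d)" for c d
    by (cases c; cases d) (auto simp: mem_component_of_degree bas_nth okubo_degree_def Z33_group_def split: if_splits)
  ultimately show "okubo_mult a b x y \<in> Z33_grading (g \<otimes>\<^bsub>Z33_group\<^esub> h)"
    unfolding okubo_mult_def Z33_grading_def by (rule bilinear_ext_graded[rotated])
next
  let ?S = "{g \<in> carrier Z33_group. Z33_grading g \<noteq> {0 :: 'k ^ okubo_basis}}"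
  interpret group Z33_group by (rule group_Z33)
  have "d \<in> generate Z33_group ?S" if "d \<in> carrier Z33_group" for d
  proof (cases "d = \<one>\<^bsub>Z33_group\<^esub>")
    case False
    then have "d \<noteq> (0, 0)" by (simp add: Z33_group_def)
    \<comment> \<open>All eight degrees other than \<open>(0, 0)\<close> are attained by basis
      elements; \<open>(0, 0)\<close> itself is supplied by \<open>generate.one\<close>.\<close>
    then have "d \<in> okubo_degree ` {X_PZ, X_MZ, X_ZP, X_ZM, X_PP, X_MM, X_MP, X_PM}"
      using that by (auto simp: carrier_Z33 okubo_degree_def)
    then obtain b where "d = okubo_degree b" by blast
    then show ?thesis
      using that component_of_degree_nonzero[of okubo_degree b]
      by (intro generate.incl) (auto simp: Z33_grading_def)
  qed (simp add: generate.one)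
  moreover have "generate Z33_group ?S \<subseteq> carrier Z33_group"
    by (rule generate_incl) auto
  ultimately show "generate Z33_group ?S = carrier Z33_group" by blast
qed

section \<open>The grading by pairs of integers\<close>

lemma group_Z2: "group Z2_group"
  unfolding Z2_group_def by (intro DirProd_group group_integer_group)

lemma generate_Z2:
  assumes "{(1, 0), (-1, 0), (0, 1), (0, -1)} \<subseteq> S"
  shows "generate Z2_group S = UNIV"
proof -
  interpret group Z2_group by (rule group_Z2)
  let ?K = "generate Z2_group S"
  have step: "(a, b) \<in> ?K \<Longrightarrow> (c, d) \<in> S \<Longrightarrow> (a + c, b + d) \<in> ?K" for a b c d
    using generate.eng[of "(a, b)" Z2_group S "(c, d)"] generate.incl[of "(c, d)" S Z2_group]
    by (simp add: Z2_group_def)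
  have 0: "(0, 0) \<in> ?K"
    using generate.one[of Z2_group S] by (simp add: Z2_group_def)
  have a: "(a, 0) \<in> ?K" for a
  proof (induction a rule: int_induct[of _ 0])
    case (step1 i) then show ?case using step[of i 0 1 0] assms by simp
  next
    case (step2 i) then show ?case using step[of i 0 "-1" 0] assms by simp
  qed (rule 0)
  have "(a, b) \<in> ?K" for a b
  proof (induction b rule: int_induct[of _ 0])
    case (step1 i) then show ?case using step[of a i 0 1] assms by simp
  next
    case (step2 i) then show ?case using step[of a i 0 "-1"] assms by simp
  qed (rule a)
  then show ?thesis by auto
qed

text \<open>Conjugation exchanges \<open>E1\<close> and \<open>E2\<close>, both of degree zero, and
  otherwise changes signs, while \<open>tau_omega\<close> is diagonal. Both preserve degrees, so the
  Petersson product inherits the grading of the Cayley product.\<close>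

lemma Z2_grading_is_group_grading:
  "group_grading Z2_group (cayley_omega_mult w) (Z2_grading :: _ \<Rightarrow> ('k::field ^ _) set)"
  unfolding group_grading_def
proof (intro conjI ballI)
  show "group Z2_group" by (rule group_Z2)
  show "is_direct_sum (carrier Z2_group) (Z2_grading :: _ \<Rightarrow> ('k ^ _) set)"
    unfolding Z2_grading_def by (rule is_direct_sum_component_of_degree) (simp add: Z2_group_def)
  have c: "conjugation cayley_norm cayley_one x \<in> Z2_grading d" if "x \<in> Z2_grading d" for x :: "'k ^ cayley_basis" and d
    using that unfolding Z2_grading_def mem_component_of_degree all_cayley_basis
    by (auto simp: conjugation_nth)
  have t: "tau_omega w x \<in> Z2_grading d" if "x \<in> Z2_grading d" for x :: "'k ^ cayley_basis" and d
    using that unfolding Z2_grading_def mem_component_of_degree all_cayley_basis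
    by (auto simp: tau_omega_nth)
  fix g h and x y :: "'k ^ cayley_basis"
  assume xy: "x \<in> Z2_grading g" "y \<in> Z2_grading h"
  have "\<forall>p q. cayley_table p q
      \<in> component_of_degree cayley_degree (cayley_degree p \<otimes>\<^bsub>Z2_group\<^esub> cayley_degree q)"
    unfolding all_cayley_basis
    by (auto simp: mem_component_of_degree bas_nth Z2_group_def split: if_splits)
  then have b: "bilinear_ext cayley_table x y \<in> Z2_grading (g \<otimes>\<^bsub>Z2_group\<^esub> h)"
    if "x \<in> Z2_grading g" "y \<in> Z2_grading h"
    for x y :: "'k ^ cayley_basis"
    using that bilinear_ext_graded[of cayley_table cayley_degree "monoid.mult Z2_group" x g y h]
    unfolding Z2_grading_def by blast
  show "cayley_omega_mult w x y \<in> Z2_grading (g \<otimes>\<^bsub>Z2_group\<^esub> h)"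
    unfolding cayley_omega_mult_def petersson_def cayley_mult_def by (rule b; intro c t xy)
next
  let ?S = "{g \<in> carrier Z2_group. Z2_grading g \<noteq> {0 :: 'k ^ cayley_basis}}"
  have "cayley_degree b \<in> ?S" for b
    using component_of_degree_nonzero[of cayley_degree b] by (simp add: Z2_grading_def Z2_group_def)
  from this[of "U 1"] this[of "V 1"] this[of "U 2"] this[of "V 2"]
  show "generate Z2_group ?S = carrier Z2_group"
    by (subst generate_Z2) (auto simp: Z2_group_def)
qed

context cube_root
begin

section \<open>Isomorphisms obtained from conjugation of matrices\<close>

lemma okubo_prod_conj:
  assumes "P * Q = 1"
  shows "okubo_prod w (Q * x * P) (Q * y * P) = Q * okubo_prod w x y * P"
proof -
  have c: "(Q * x * P) * (Q * y * P) = Q * (x * y) * P" for x y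
  proof -
    have "(Q * x * P) * (Q * y * P) = Q * x * (P * Q) * y * P" by (simp only: mult.assoc)
    then show ?thesis by (simp only: assms mult_1_right mult.assoc)
  qed
  have t: "tr (Q * x * P) = tr x" for x
  proof -
    have "tr (Q * x * P) = tr (P * Q * x)" by (metis tr_mult_commute mult.assoc)
    then show ?thesis by (simp add: assms)
  qed
  have QP: "Q * P = 1" using assms by (rule mat3_left_inverse_imp_right_inverse)
  show ?thesis
    unfolding okubo_prod_def c t
    by (simp add: left_diff_distrib right_diff_distrib mult.assoc scal_left_commute[of Q] scal_commute[of Q])
       (simp add: QP mult.assoc[symmetric] scal_mult)
qed

lemma algebra_iso_of_models:
  assumes "sl3_model w m1 \<Theta>1" "sl3_model w m2 \<Theta>2" "P * Q = 1" "Q * P = 1"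
  obtains \<phi> where "algebra_iso m1 m2 \<phi>" "\<And>x. \<Theta>2 (\<phi> x) = Q * \<Theta>1 x * P"
proof -
  have tr: "tr (Q * x * P) = tr x" "tr (P * x * Q) = tr x" for x
    using assms(3,4) by (metis tr_mult_commute mult.assoc mult_1_left)+
  have range2: "range \<Theta>2 = {x. tr x = 0}" and range1: "range \<Theta>1 = {x. tr x = 0}"
    and inj1: "inj \<Theta>1" and inj2: "inj \<Theta>2" 
    and hom: "\<Theta>1 (m1 x y) = okubo_prod w (\<Theta>1 x) (\<Theta>1 y)" "\<Theta>2 (m2 x' y') = okubo_prod w (\<Theta>2 x') (\<Theta>2 y')"
    and add: "\<Theta>1 (x + y) = \<Theta>1 x + \<Theta>1 y" "\<Theta>2 (x' + y') = \<Theta>2 x' + \<Theta>2 y'"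
    and scale: "\<Theta>1 (c *s x) = scal c * \<Theta>1 x" "\<Theta>2 (c *s x') = scal c * \<Theta>2 x'" for x y x' y' c
    using assms(1,2) unfolding sl3_model_def by blast+
  define \<phi> where "\<phi> x = inv_into UNIV \<Theta>2 (Q * \<Theta>1 x * P)" for x
  have \<phi>: "\<Theta>2 (\<phi> x) = Q * \<Theta>1 x * P" for x
    unfolding \<phi>_def by (rule f_inv_into_f) (use range1 range2 tr in auto)
  have eqI: "x = y" if "\<Theta>2 x = \<Theta>2 y" for x y using inj2 that by (simp add: inj_eq)
  have untwist: "P * (Q * x * P) * Q = x" for x
  proof -
    have "P * (Q * x * P) * Q = (P * Q) * x * (P * Q)" by (simp only: mult.assoc)
    then show ?thesis by (simp only: assms(3) mult_1_left mult_1_right)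
  qed
  have "algebra_iso m1 m2 \<phi>"
    unfolding algebra_iso_def Vector_Spaces.linear_iff
  proof (intro conjI allI)
    show "\<phi> (x + y) = \<phi> x + \<phi> y" for x y
      by (rule eqI) (simp add: \<phi> add algebra_simps)
    show "\<phi> (c *s x) = c *s \<phi> x" for c x
      by (rule eqI) (simp add: \<phi> scale mult.assoc scal_left_commute[of Q])
    show "\<phi> (m1 x y) = m2 (\<phi> x) (\<phi> y)" for x y
      by (rule eqI) (simp add: \<phi> hom okubo_prod_conj[OF assms(3)])
    show "bij \<phi>"
    proof (rule bijI)
      show "inj \<phi>"
        by (rule injI) (metis \<phi> untwist inj1 injD)
      have "y \<in> range \<phi>" for y
      proof -
        have "tr (\<Theta>2 y) = 0" using range2 by blast
        then have "P * \<Theta>2 y * Q \<in> range \<Theta>1" unfolding range1 by (simp add: tr)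
        then obtain x where x: "\<Theta>1 x = P * \<Theta>2 y * Q" by (metis imageE)
        have "\<Theta>2 (\<phi> x) = (Q * P) * \<Theta>2 y * (Q * P)" by (simp only: \<phi> x mult.assoc)
        then have "y = \<phi> x" using assms(4) eqI by simp
        then show ?thesis by blast
      qed
      then show "surj \<phi>" by blast
    qed
  qed (rule vec.vector_space_axioms)+
  then show thesis using \<phi> that by blast
qed

end

section \<open>From direct sums to coarsenings\<close>

lemma is_direct_sum_induct:
  assumes "is_direct_sum I A" "P 0" "\<And>i x. i \<in> I \<Longrightarrow> x \<in> A i \<Longrightarrow> P x"
    "\<And>x y. P x \<Longrightarrow> P y \<Longrightarrow> P (x + y)"
  shows "P z"
proof -
  obtain c where c: "\<forall>i\<in>I. c i \<in> A i" "\<forall>i. i \<notin> I \<longrightarrow> c i = 0" "z = (\<Sum>i | c i \<noteq> 0. c i)"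
    using assms(1) unfolding is_direct_sum_def by blast
  have "P (\<Sum>i\<in>J. c i)" if "finite J" for J
    using that
  proof (induction J)
    case (insert i J)
    have "P (c i)" using c assms(2,3) by (cases "i \<in> I") auto
    then show ?case using insert assms(4) by simp
  qed (use assms(2) in simp)
  then show ?thesis using c(3) assms(2) by (cases "finite {i. c i \<noteq> 0}") auto
qed

lemma is_direct_sum_independent:
  fixes A :: "'a \<Rightarrow> ('b::field ^ 'c::finite) set"
  assumes "is_direct_sum I A" "f \<in> I" "g \<in> I" "h \<in> I" "x \<in> A g" "y \<in> A h" "x + y \<in> A f" "x + y \<noteq> 0"
  shows "f = g \<or> f = h"
proof (rule ccontr)
  assume neg: "\<not> ?thesis"
  have sub: "vec.subspace (A i)" if "i \<in> I" for i using assms(1) that unfolding is_direct_sum_def by blast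
  let ?D = "\<lambda>c. (\<forall>i\<in>I. c i \<in> A i) \<and> (\<forall>i. i \<notin> I \<longrightarrow> c i = 0) \<and>
              finite {i. c i \<noteq> 0} \<and> x + y = (\<Sum>i | c i \<noteq> 0. c i)"
  let ?c = "\<lambda>i. if i = f then x + y else 0"
  \<comment> \<open>Writing the family as a sum also covers \<open>g = h\<close>, where its single
    component is \<open>x + y\<close>.\<close>
  let ?d = "\<lambda>i. (if i = g then x else 0) + (if i = h then y else 0)"
  have "{i. ?c i \<noteq> 0} = {f}" using assms(8) by auto
  then have c: "?D ?c" using assms sub by (auto intro: vec.subspace_0)
  have s: "{i. ?d i \<noteq> 0} \<subseteq> {g, h}" by auto
  have "(\<Sum>i | ?d i \<noteq> 0. ?d i) = (\<Sum>i\<in>{g, h}. ?d i)"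
    by (rule sum.mono_neutral_left) auto
  also have "\<dots> = x + y" by (simp add: sum.distrib)
  finally have d: "?D ?d"
  proof (intro conjI)
    show "finite {i. ?d i \<noteq> 0}" by (rule finite_subset[OF s]) simp
  qed (use assms sub in \<open>auto intro: vec.subspace_0 vec.subspace_add\<close>)
  have ex: "\<exists>!c. ?D c" using assms(1) unfolding is_direct_sum_def by (elim conjE allE[of _ "x + y"])
  have uniq: "a = b" if "\<exists>!c. Q c" "Q a" "Q b" for Q and a b :: "'a \<Rightarrow> 'b ^ 'c"
    using that by blast
  have "?c = ?d" by (rule uniq[of ?D]) (fact ex c d)+
  then have "?c f = ?d f" by metis
  then show False using neg assms(8) by simp
qed

lemma coarseningI:
  assumes "group_grading G m A" "algebra_iso m m' \<phi>"
    "\<And>d. \<exists>g\<in>carrier G. \<forall>b. deg b = d \<longrightarrow> bas b \<in> \<phi> ` A g"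
  shows "coarsening G (transport \<phi> A) K (component_of_degree deg)"
  unfolding coarsening_def transport_def
proof
  fix d
  obtain g where g: "g \<in> carrier G" "\<forall>b. deg b = d \<longrightarrow> bas b \<in> \<phi> ` A g"
    using assms(3) by blast
  have "vec.subspace (A g)"
    using assms(1) g(1) unfolding group_grading_def is_direct_sum_def by blast
  moreover have "Vector_Spaces.linear (*s) (*s) \<phi>" using assms(2) unfolding algebra_iso_def by blast
  ultimately have "vec.subspace (\<phi> ` A g)" using vec.linear_subspace_image by blast
  then have "component_of_degree deg d \<subseteq> \<phi> ` A g"
    unfolding component_of_degree_def using g(2) by (intro vec.span_minimal) auto
  then show "\<exists>g\<in>carrier G. component_of_degree deg d \<subseteq> \<phi> ` A g" using g(1) by blast
qed

section \<open>Classification of the gradings\<close>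

lemma cube_root_of_primitive_root:
  fixes w :: "'k::field"
  assumes "CHAR('k) \<noteq> 3" "primitive_root_of_one 3 w"
  shows "cube_root w"
proof
  show "(3::'k) \<noteq> 0"
  proof
    assume "(3::'k) = 0"
    then have "CHAR('k) dvd 3" using of_nat_eq_0_iff_char_dvd[of 3, where ?'a = 'k] by simp
    moreover have "prime (3::nat)" by simp
    ultimately have "CHAR('k) = 1 \<or> CHAR('k) = 3" unfolding prime_nat_iff by blast
    then show False using assms(1) CHAR_not_1'[where ?'a = 'k] by simp
  qed
  have "w ^ 3 = 1" "w ^ 1 \<noteq> 1" using assms(2) unfolding primitive_root_of_one_def by auto
  then have "(w - 1) * (w * w + w + 1) = 0" "w - 1 \<noteq> 0" by (simp_all add: algebra_simps power3_eq_cube)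
  then have "w * w + w + 1 = 0" by simp
  then show "w * w = - 1 - w" by (simp add: algebra_simps add_eq_0_iff)
qed

lemma graded_sl3_of_group_grading:
  fixes G :: "('g, 'm) monoid_scheme" and w :: "'k::alg_closed_field"
  assumes "group_grading G m A" "sl3_model w m \<Theta>" "cube_root w"
  shows "graded_sl3 w G (\<lambda>g. \<Theta> ` A g)"
proof -
  interpret cube_root w by fact
  interpret group G using assms(1) unfolding group_grading_def by blast
  have ds: "is_direct_sum (carrier G) A"
    and mult: "\<lbrakk>g \<in> carrier G; h \<in> carrier G; x \<in> A g; y \<in> A h\<rbrakk> \<Longrightarrow> m x y \<in> A (g \<otimes>\<^bsub>G\<^esub> h)" for g h x y
    using assms(1) unfolding group_grading_def by blast+
  have sub: "vec.subspace (A g)" if "g \<in> carrier G" for g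
    using ds that unfolding is_direct_sum_def by blast
  have add: "\<Theta> (x + y) = \<Theta> x + \<Theta> y" and scale: "\<Theta> (c *s x) = scal c * \<Theta> x"
    and inj: "inj \<Theta>" and range: "range \<Theta> = {x. tr x = 0}"
    and hom: "\<Theta> (m x y) = okubo_prod w (\<Theta> x) (\<Theta> y)" for x y c
    using assms(2) unfolding sl3_model_def by blast+
  have zero: "\<Theta> 0 = 0" using scale[of 0 0] by simp
  show ?thesis
  proof unfold_locales
    show "0 \<in> \<Theta> ` A g" if "g \<in> carrier G" for g
      using vec.subspace_0[OF sub[OF that]] zero by (metis image_eqI)
    show "x + y \<in> \<Theta> ` A g" if "g \<in> carrier G" "x \<in> \<Theta> ` A g" "y \<in> \<Theta> ` A g" for g x y
      using that vec.subspace_add[OF sub[OF that(1)]] by (auto simp flip: add)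
    show "scal c * x \<in> \<Theta> ` A g" if "g \<in> carrier G" "x \<in> \<Theta> ` A g" for g x c
      using that vec.subspace_scale[OF sub[OF that(1)]] by (auto simp flip: scale)
    show "tr x = 0" if "x \<in> \<Theta> ` A g" for g x
      using that range by blast
    show "okubo_prod w x y \<in> \<Theta> ` A (g \<otimes>\<^bsub>G\<^esub> h)"
      if "g \<in> carrier G" "h \<in> carrier G" "x \<in> \<Theta> ` A g" "y \<in> \<Theta> ` A h" for g h x y
      using that mult by (auto simp flip: hom)
    show "P z" if "tr z = 0" "P 0" "\<And>g x. g \<in> carrier G \<Longrightarrow> x \<in> \<Theta> ` A g \<Longrightarrow> P x"
      "\<And>x y. P x \<Longrightarrow> P y \<Longrightarrow> P (x + y)" for P z
    proof -
      have "z \<in> range \<Theta>" using that(1) range by blast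
      then obtain z' where z: "z = \<Theta> z'" by blast
      have "P (\<Theta> z')"
        by (rule is_direct_sum_induct[OF ds, of "\<lambda>x. P (\<Theta> x)"]) (use that zero add in auto)
      then show ?thesis by (simp add: z)
    qed
    show "f = g \<or> f = h" if fgh: "f \<in> carrier G" "g \<in> carrier G" "h \<in> carrier G"
      and xy: "x \<in> \<Theta> ` A g" "y \<in> \<Theta> ` A h" "x + y \<in> \<Theta> ` A f" "x + y \<noteq> 0" for f g h x y
    proof -
      obtain x' y' z' where x: "x = \<Theta> x'" "x' \<in> A g" and y: "y = \<Theta> y'" "y' \<in> A h"
        and z: "x + y = \<Theta> z'" "z' \<in> A f" using xy by blast
      have "z' = x' + y'" using inj x y z add by (metis injD)
      moreover have "z' \<noteq> 0" using z xy(4) zero by metis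
      ultimately show ?thesis
        using is_direct_sum_independent[OF ds fgh x(2) y(2)] z(2) by blast
    qed
  qed
qed

lemma (in cube_root) coarsening_of_models:
  assumes "sl3_model w m1 \<Theta>1" "sl3_model w m2 \<Theta>2" "P * Q = 1" "Q * P = 1" "group_grading G m1 A"
    and deg: "\<And>d. \<exists>g\<in>carrier G. \<forall>b. deg b = d \<longrightarrow> P * \<Theta>2 (bas b) * Q \<in> \<Theta>1 ` A g"
  shows "\<exists>\<phi>. algebra_iso m1 m2 \<phi> \<and> coarsening G (transport \<phi> A) K (component_of_degree deg)"
proof -
  obtain \<phi> where \<phi>: "algebra_iso m1 m2 \<phi>" "\<And>x. \<Theta>2 (\<phi> x) = Q * \<Theta>1 x * P"
    using algebra_iso_of_models[OF assms(1-4)] by blast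
  have "z \<in> \<phi> ` A g" if "P * \<Theta>2 z * Q \<in> \<Theta>1 ` A g" for z g
  proof -
    obtain a where a: "a \<in> A g" "\<Theta>1 a = P * \<Theta>2 z * Q" using \<open>P * _ * Q \<in> _\<close> by (metis imageE)
    have "\<Theta>2 (\<phi> a) = (Q * P) * \<Theta>2 z * (Q * P)" by (simp only: \<phi>(2) a(2) mult.assoc)
    then have "\<phi> a = z" using assms(2,4) unfolding sl3_model_def by (simp add: inj_eq)
    then show ?thesis using a(1) by blast
  qed
  then have "\<exists>g\<in>carrier G. \<forall>b. deg b = d \<longrightarrow> bas b \<in> \<phi> ` A g" for d using deg[of d] by blast
  then have "coarsening G (transport \<phi> A) K (component_of_degree deg)"
    by (rule coarseningI[OF assms(5) \<phi>(1)])
  then show ?thesis using \<phi>(1) by blast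
qed

lemma (in cube_root) cayley_omega_model_bas:
  "cayley_omega_model (bas E1) =
     scal (- r) * outer unit1 unit1 + scal (- r * w) * outer unit2 unit2 + scal (- r * w ^ 2) * outer unit3 unit3"
  "cayley_omega_model (bas E2) =
     scal (- r) * outer unit1 unit1 + scal (- r * w ^ 2) * outer unit2 unit2 + scal (- r * w) * outer unit3 unit3"
  "cayley_omega_model (bas (U 0)) = outer unit3 unit2" "cayley_omega_model (bas (U 1)) = outer unit1 unit3"
  "cayley_omega_model (bas (U 2)) = outer unit2 unit1" "cayley_omega_model (bas (V 0)) = scal (- 1) * outer unit2 unit3"
  "cayley_omega_model (bas (V 1)) = scal (- 1) * outer unit3 unit1"
  "cayley_omega_model (bas (V 2)) = scal (- 1) * outer unit1 unit2"
  by (simp_all add: Let_def bas_nth unit1_def unit2_def unit3_def scal_def)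

lemma (in cube_root) okubo_model_bas:
  "okubo_model (bas X_PZ) = scal r * clock w"
  "okubo_model (bas X_MZ) = scal r * (clock w * clock w)"
  "okubo_model (bas X_ZP) = scal r * shift"
  "okubo_model (bas X_ZM) = scal r * (shift * shift)"
  "okubo_model (bas X_PP) = scal (r * w) * (clock w * shift)"
  "okubo_model (bas X_MM) = scal (r * w) * (clock w * clock w * (shift * shift))"
  "okubo_model (bas X_MP) = scal (r * w ^ 2) * (clock w * clock w * shift)"
  "okubo_model (bas X_PM) = scal (r * w ^ 2) * (clock w * (shift * shift))"
  by (simp_all add: Let_def bas_nth clock_def shift_def scal_def w_powers)
     (simp_all add: algebra_simps w_square w_square')

text \<open>Apart from \<open>E1\<close> and \<open>E2\<close>, distinct basis elements have
  distinct degrees, so homogeneity of the conjugated matrix units suffices for them.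
  \<open>E1\<close> and \<open>E2\<close> share a degree, but their images are combinations of the
  diagonal idempotents and so both lie in degree \<open>\<one>\<close>.\<close>

lemma (in graded_sl3) coarsening_of_diagonal:
  assumes B_def: "B = (\<lambda>g. \<Theta> ` A g)" and "sl3_model w m \<Theta>" "group_grading G m A" "P * Q = 1" "Q * P = 1"
    and diag: "\<forall>i\<in>{unit1, unit2, unit3}. P * outer i i * Q \<in> H \<one>"
    and hom: "\<forall>i\<in>{unit1, unit2, unit3}. \<forall>j\<in>{unit1, unit2, unit3}.
      \<exists>g\<in>carrier G. P * outer i j * Q \<in> H g"
  shows "\<exists>\<phi>. algebra_iso m (cayley_omega_mult w) \<phi> \<and> coarsening G (transport \<phi> A) Z2_group Z2_grading"
proof -
  let ?c = "\<lambda>b. P * cayley_omega_model (bas b) * Q"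
  have tr: "tr (?c b) = 0" for b
  proof -
    have "tr (?c b) = tr (Q * P * cayley_omega_model (bas b))" by (metis tr_mult_commute mult.assoc)
    then show ?thesis using assms(5) cayley_omega_model_tr by simp
  qed
  have conj: "P * (scal c * x) * Q = scal c * (P * x * Q)" "P * (x + y) * Q = P * x * Q + P * y * Q" for c x y
    by (simp_all add: mult.assoc scal_left_commute[of P] algebra_simps)
  have 0: "?c E1 \<in> H \<one>" "?c E2 \<in> H \<one>"
    unfolding cayley_omega_model_bas conj
    by (intro H_add' H_scal' one_closed; use diag in simp)+
  have ex: "\<exists>g\<in>carrier G. scal c * (P * outer i j * Q) \<in> H g"
    if "i \<in> {unit1, unit2, unit3}" "j \<in> {unit1, unit2, unit3}" for i j c
    using hom that H_scal' by blast
  have "\<forall>b. \<exists>g\<in>carrier G. ?c b \<in> H g"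
    unfolding all_cayley_basis
    using 0 ex[of unit3 unit2 1] ex[of unit1 unit3 1] ex[of unit2 unit1 1]
      ex[of unit2 unit3 "- 1"] ex[of unit3 unit1 "- 1"] ex[of unit1 unit2 "- 1"]
    by (simp only: cayley_omega_model_bas conj) auto
  then obtain f where f: "\<And>b. f b \<in> carrier G" "\<And>b. ?c b \<in> H (f b)" by metis
  have B: "?c b \<in> \<Theta> ` A (f b)" "?c E1 \<in> \<Theta> ` A \<one>" "?c E2 \<in> \<Theta> ` A \<one>" for b
    using H_tr_zero f tr 0 unfolding B_def by auto
  have inj: "b = b'" if "cayley_degree b = cayley_degree b'" "b \<notin> {E1, E2}" for b b'
  proof -
    have "\<forall>b b'. cayley_degree b = cayley_degree b' \<longrightarrow> b \<notin> {E1, E2} \<longrightarrow> b = b'"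
      unfolding all_cayley_basis by simp
    then show ?thesis using that by blast
  qed
  have "\<exists>g\<in>carrier G. \<forall>b. cayley_degree b = d \<longrightarrow> ?c b \<in> \<Theta> ` A g" for d
  proof (cases "\<exists>b. cayley_degree b = d \<and> b \<notin> {E1, E2}")
    case True
    then obtain b where "cayley_degree b = d" "b \<notin> {E1, E2}" by blast
    then show ?thesis using inj B(1)[of b] f(1)[of b] by metis
  next
    case False
    \<comment> \<open>Either \<open>d\<close> is the degree of \<open>E1\<close> and
      \<open>E2\<close>, or no basis element has degree \<open>d\<close>; the component of degree
      \<open>\<one>\<close> serves for both.\<close>
    then show ?thesis using B(2,3) one_closed by blast
  qed
  then show ?thesis
    unfolding Z2_grading_def using coarsening_of_models[OF assms(2) sl3_model_cayley_omega assms(4,5,3)] by blast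
qed

text \<open>Up to scalars the basis elements are monomials in clock and shift, hence homogeneous
  after conjugation, and no two of them share a degree.\<close>

lemma (in graded_sl3) coarsening_of_pauli:
  assumes B_def: "B = (\<lambda>g. \<Theta> ` A g)" and "sl3_model w m \<Theta>" "group_grading G m A" "P * Q = 1" "Q * P = 1"
    and gh: "g \<in> carrier G" "h \<in> carrier G"
    and hom: "P * clock w * Q \<in> H g"
      "P * shift * Q \<in> H h"
  shows "\<exists>\<phi>. algebra_iso m (okubo_mult 1 1) \<phi> \<and> coarsening G (transport \<phi> A) Z33_group Z33_grading"
proof -
  have model: "sl3_model w (okubo_mult 1 1) okubo_model"
  proof -
    have "okubo_rescale 1 1 x = x" for x :: "'k ^ okubo_basis" by (simp add: okubo_rescale_def vec_eq_iff)
    then show ?thesis using sl3_model_okubo[of 1 1] by (simp del: okubo_model.simps)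
  qed
  let ?c = "\<lambda>b. P * okubo_model (bas b) * Q"
  have tr: "tr (?c b) = 0" for b
  proof -
    have "tr (?c b) = tr (Q * P * okubo_model (bas b))" by (metis tr_mult_commute mult.assoc)
    then show ?thesis using assms(5) okubo_model_tr by simp
  qed
  define homog where "homog x \<longleftrightarrow> (\<exists>g\<in>carrier G. P * x * Q \<in> H g)" for x
  have scale: "homog (scal c * x)" if "homog x" for c x
    using that H_scal' unfolding homog_def by (metis mult.assoc scal_left_commute)
  have mult: "homog (x * y)" if xy: "homog x" "homog y" for x y
  proof -
    obtain g h where "g \<in> carrier G" "h \<in> carrier G" "P * x * Q \<in> H g" "P * y * Q \<in> H h"
      using xy unfolding homog_def by blast
    then have "(P * x * Q) * (P * y * Q) \<in> H (g \<otimes> h)" "g \<otimes> h \<in> carrier G" using H_mult' by auto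
    moreover have "P * x * Q * (P * y * Q) = P * (x * y) * Q"
    proof -
      have "P * x * Q * (P * y * Q) = P * x * (Q * P) * y * Q" by (simp only: mult.assoc)
      also have "\<dots> = P * (x * y) * Q" by (simp only: assms(5) mult_1_right mult.assoc)
      finally show ?thesis .
    qed
    ultimately show ?thesis unfolding homog_def by auto
  qed
  have "homog (clock w)" "homog shift" using gh hom unfolding homog_def by blast+
  then have "homog (okubo_model (bas b))" for b
    by (cases b; simp only: okubo_model_bas; intro scale mult)
  then have B: "\<exists>g\<in>carrier G. ?c b \<in> \<Theta> ` A g" for b
    using H_tr_zero tr unfolding homog_def B_def by blast
  have inj: "b = b'" if "okubo_degree b = okubo_degree b'" for b b'
    using that by (cases b; cases b'; simp add: okubo_degree_def)
  have "\<exists>g\<in>carrier G. \<forall>b. okubo_degree b = d \<longrightarrow> ?c b \<in> \<Theta> ` A g" for d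
  proof (cases "\<exists>b. okubo_degree b = d")
    case True
    then show ?thesis using inj B by metis
  next
    case False
    then show ?thesis using one_closed by blast
  qed
  then show ?thesis
    unfolding Z33_grading_def using coarsening_of_models[OF assms(2) model assms(4,5,3)] by blast
qed

theorem mainTheorem2:
  fixes \<omega> :: "'k::alg_closed_field"
  assumes "CHAR('k) \<noteq> 3"
    and "primitive_root_of_one 3 \<omega>"
  shows "(\<exists>\<phi>. algebra_iso pseudo_octonion_mult (cayley_omega_mult \<omega>) \<phi>) \<and>
     group_grading Z2_group (cayley_omega_mult \<omega>) Z2_grading \<and>
     (\<forall>\<alpha> \<beta>::'k. \<alpha> \<noteq> 0 \<and> \<beta> \<noteq> 0 \<longrightarrow>
        (\<exists>\<phi>. algebra_iso pseudo_octonion_mult (okubo_mult \<alpha> \<beta>) \<phi>) \<and>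
        group_grading Z33_group (okubo_mult \<alpha> \<beta>) Z33_grading) \<and>
     (\<forall>(G::('g, 'm) monoid_scheme) A.
        group_grading G (pseudo_octonion_mult :: 'k ^ cayley_basis \<Rightarrow> _) A \<and> nontrivial_grading G A \<longrightarrow>
          (\<exists>\<phi>. algebra_iso pseudo_octonion_mult (cayley_omega_mult \<omega>) \<phi> \<and>
               coarsening G (transport \<phi> A) Z2_group Z2_grading) \<or>
          (\<exists>\<alpha> \<beta>. \<alpha> \<noteq> 0 \<and> \<beta> \<noteq> 0 \<and>
             (\<exists>\<phi>. algebra_iso pseudo_octonion_mult (okubo_mult \<alpha> \<beta>) \<phi> \<and>
                  coarsening G (transport \<phi> A) Z33_group Z33_grading)))"
proof -
  interpret cube_root \<omega> using assms by (rule cube_root_of_primitive_root)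
  note model = sl3_model_pseudo_octonion
  let ?\<Theta> = "\<lambda>x. cayley_omega_model (st_to_omega x)"
  have iso_omega: "\<exists>\<phi>. algebra_iso pseudo_octonion_mult (cayley_omega_mult \<omega>) \<phi>"
    using algebra_iso_of_models[OF model sl3_model_cayley_omega, of 1 1] by auto
  have iso_okubo: "\<exists>\<phi>. algebra_iso pseudo_octonion_mult (okubo_mult \<alpha> \<beta>) \<phi>"
    if "\<alpha> \<noteq> 0" "\<beta> \<noteq> 0" for \<alpha> \<beta> :: 'k
  proof -
    obtain a where a: "a ^ 3 = \<alpha>" using nth_root_exists[of 3 \<alpha>] by auto
    obtain b where b: "b ^ 3 = \<beta>" using nth_root_exists[of 3 \<beta>] by auto
    have "a \<noteq> 0" "b \<noteq> 0" using a b that by auto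
    then show ?thesis
      using algebra_iso_of_models[OF model sl3_model_okubo[of a b], of 1 1] a b by auto
  qed
  have coarsen: "(\<exists>\<phi>. algebra_iso pseudo_octonion_mult (cayley_omega_mult \<omega>) \<phi> \<and>
               coarsening G (transport \<phi> A) Z2_group Z2_grading) \<or>
          (\<exists>\<alpha> \<beta>. \<alpha> \<noteq> 0 \<and> \<beta> \<noteq> 0 \<and>
             (\<exists>\<phi>. algebra_iso pseudo_octonion_mult (okubo_mult \<alpha> \<beta>) \<phi> \<and>
                  coarsening G (transport \<phi> A) Z33_group Z33_grading))"
    if A: "group_grading G (pseudo_octonion_mult :: 'k ^ cayley_basis \<Rightarrow> _) A"
    for G :: "('g, 'm) monoid_scheme" and A
  proof -
    note gr = graded_sl3_of_group_grading[OF A model cube_root_axioms]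
    from graded_sl3.diagonal_or_pauli[OF gr] show ?thesis
    proof (elim disjE exE conjE)
      fix P Q
      assume "P * Q = 1" "Q * P = 1"
        "\<forall>i\<in>{unit1, unit2, unit3}. P * outer i i * Q \<in> graded_sl3.H G (\<lambda>g. ?\<Theta> ` A g) \<one>\<^bsub>G\<^esub>"
        "\<forall>i\<in>{unit1, unit2, unit3}. \<forall>j\<in>{unit1, unit2, unit3}. \<exists>g\<in>carrier G.
          P * outer i j * Q \<in> graded_sl3.H G (\<lambda>g. ?\<Theta> ` A g) g"
      then show ?thesis
        by (intro disjI1 graded_sl3.coarsening_of_diagonal[OF gr refl model A])
    next
      fix P Q g h
      assume "P * Q = 1" "Q * P = 1" "g \<in> carrier G" "h \<in> carrier G"
        "P * clock \<omega> * Q \<in> graded_sl3.H G (\<lambda>g. ?\<Theta> ` A g) g"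
        "P * shift * Q \<in> graded_sl3.H G (\<lambda>g. ?\<Theta> ` A g) h"
      then have "\<exists>\<phi>. algebra_iso pseudo_octonion_mult (okubo_mult 1 1) \<phi> \<and>
          coarsening G (transport \<phi> A) Z33_group Z33_grading"
        by (rule graded_sl3.coarsening_of_pauli[OF gr refl model A])
      \<comment> \<open>The normalized clock and shift matrices have cube 1, which corresponds to
        the parameters \<open>\<alpha> = \<beta> = 1\<close>.\<close>
      then show ?thesis by (intro disjI2 exI[of _ 1] conjI one_neq_zero)
    qed
  qed
  show ?thesis
    by (intro conjI allI impI Z2_grading_is_group_grading Z33_grading_is_group_grading iso_omega;
        (elim conjE)?; (rule iso_okubo coarsen; assumption)?)
qed

end
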